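(* Let $s$ be a composition (without zeros). The equivalence relation $\equiv_{\pi_\uparrow}$ (or equivalently any of $\equiv$ or $\equiv_{\pi_\downarrow}$, these three relations being the same) is a lattice congruence of the $s$-weak order. Moreover, the $s$-Tamari lattice is (up to isomorphism) the quotient lattice of the $s$-weak order determined by $\equiv_{\pi_\downarrow}$.
   Context: A composition is a finite sequence $s=(s(1),\dots,s(n))$ of positive integers. An $s$-decreasing tree is a rooted planar tree with exactly $n$ internal nodes, labelled bijectively by $1,\dots,n$ (an internal node is identified with its label; the other nodes are unlabelled leaves), such that internal node $i$ has exactly $s(i)+1$ ordered children and all internal nodes that are descendants of $i$ have labels smaller than $i$. For a node $y$ of $T$, $T^y_0,\dots,T^y_{s(y)}$ denote its child subtrees from left to right, and $x\in T^y_i$ means that internal node $x$ lies in that subtree. If $x<y$ and $x$ is not a descendant of $y$, let $z$ be the first (closest) common ancestor of $x$ and $y$, with $x\in T^z_j$, $y\in T^z_i$, $i\neq j$; $x$ is left of $y$ if $j<i$ and right of $y$ if $j>i$. For $x<y$ the cardinality $\#_T(y,x)$ is: $0$ if $x$ is left of $y$; $i$ if $x\in T^y_i$; $s(y)$ if $x$ is right of $y$. $\operatorname{inv}(T)$ is the multiset of pairs $(y,x)$, $1\le x<y\le n$, with multiplicities $\#_T(y,x)$; $T$ is determined by $\operatorname{inv}(T)$. The $s$-weak order is defined by $R\preccurlyeq T$ iff $\#_R(y,x)\le \#_T(y,x)$ for all $x<y$; it is a lattice. An $s$-decreasing tree $T$ is an $s$-Tamari tree if $\#_T(c,a)\le\#_T(c,b)$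 for all $a<b<c$; the $s$-Tamari lattice is the restriction of the $s$-weak order to $s$-Tamari trees. Projections. For an $s$-decreasing tree $T$, $\pi_\downarrow(T)$ is the $s$-decreasing tree $Q$ with $\#_Q(c,a)=\min\{\#_T(c,b): a\le b<c\}$ for all $a<c$, and $\pi_\uparrow(T)$ is the $s$-decreasing tree $R$ with $\#_R(c,a)=s(c)$ if there exists $b$ with $a<b<c$ and $\#_T(b,a)=s(b)$, and $\#_R(c,a)=\#_T(c,a)$ otherwise (both trees exist). Define $T\equiv_{\pi_\downarrow}T'$ iff $\pi_\downarrow(T)=\pi_\downarrow(T')$, and $T\equiv_{\pi_\uparrow}T'$ iff $\pi_\uparrow(T)=\pi_\uparrow(T')$. Rotations. For a multiset $I$ of pairs $(y,x)$, $x<y$, with multiplicities $\#_I(y,x)$, $I+(c,a)$ increases the multiplicity of $(c,a)$ by one, and $I^{\mathsf{tc}}$ is the multiset where the multiplicity of $(c,a)$ is the maximum of $\#_I(b_1,b_2)$ over all lists $c=b_1>\dots>b_k=a$, $k\ge 2$, with all $\#_I(b_i,b_{i+1})>0$ ($0$ if there is none). A pair $(a,c)$, $a<c$, is a tree-ascent of $T$ if: (i) $a$ is a descendant of $c$; (ii) $a\notin T^c_{s(c)}$; (iii) if $a$ is a descendant of $b$ with $c>b>a$, then $a\in T^b_{s(b)}$; (iv) if $s(a)>0$, then $T^a_{s(a)}$ contains no internal node. The corresponding $s$-tree rotation replaces $T$ by the $s$-decreasing tree $T'$ with $\operatorname{inv}(T')=(\operatorname{inv}(T)+(c,a))^{\mathsf{tc}}$.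 It is an $s$-congruence rotation if there exists $b$ with $a<b<c$ and $\#_T(b,a)=s(b)$. Define $T\equiv T'$ iff $T$ and $T'$ can be connected by a sequence of $s$-congruence rotations (used in either direction). An equivalence relation $\alpha$ on a finite lattice $L$ is a lattice congruence if each class is an interval of $L$ and the maps sending each element to the bottom, respectively top, element of its class are order-preserving. The quotient $L/\alpha$ is the poset on the classes with $X\preccurlyeq Y$ iff there are $x\in X$, $y\in Y$ with $x\preccurlyeq y$; it is a lattice. *)

theory Defs
  imports "HOL-Algebra.Lattice" "HOL-Library.Multiset"
begin

section \<open>Decreasing trees\<close>

text \<open>
  A composition \<open>(s(1), \<dots>, s(n))\<close> is given by its length \<open>n\<close> and a function \<open>s\<close>
  of which only the values on \<open>{1..n}\<close> matter.
\<close>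

definition composition :: "nat \<Rightarrow> (nat \<Rightarrow> nat) \<Rightarrow> bool"
  where "composition n s \<longleftrightarrow> (\<forall>i\<in>{1..n}. 0 < s i)"

datatype planar_tree = Leaf | Node nat "planar_tree list"

text \<open>The labels of the internal nodes, in preorder and with repetitions.\<close>

primrec labels :: "planar_tree \<Rightarrow> nat list"
  where
    "labels Leaf = []"
  | "labels (Node y ts) = y # concat (map labels ts)"

text \<open>All full subtrees, one for each (internal or leaf) node, the tree itself included.\<close>

primrec subtrees :: "planar_tree \<Rightarrow> planar_tree set"
  where
    "subtrees Leaf = {Leaf}"
  | "subtrees (Node y ts) = insert (Node y ts) (\<Union>(set (map subtrees ts)))"

definition decreasing_trees :: "nat \<Rightarrow> (nat \<Rightarrow> nat) \<Rightarrow> planar_tree set"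
  where "decreasing_trees n s =
    {T. distinct (labels T) \<and> set (labels T) = {1..n} \<and>
        (\<forall>y ts. Node y ts \<in> subtrees T \<longrightarrow>
           length ts = s y + 1 \<and> (\<forall>t\<in>set ts. \<forall>x\<in>set (labels t). x < y))}"

text \<open>\<open>in_child T y i x\<close> is \<open>x \<in> T\<^sup>y\<^sub>i\<close>, for an internal node \<open>x\<close>.\<close>

definition in_child :: "planar_tree \<Rightarrow> nat \<Rightarrow> nat \<Rightarrow> nat \<Rightarrow> bool"
  where "in_child T y i x \<longleftrightarrow>
    (\<exists>ts. Node y ts \<in> subtrees T \<and> i < length ts \<and> x \<in> set (labels (ts ! i)))"

definition descendant :: "planar_tree \<Rightarrow> nat \<Rightarrow> nat \<Rightarrow> bool"
  where "descendant T x y \<longleftrightarrow> (\<exists>i. in_child T y i x)"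

definition first_common_ancestor :: "planar_tree \<Rightarrow> nat \<Rightarrow> nat \<Rightarrow> nat \<Rightarrow> bool"
  where "first_common_ancestor T x y z \<longleftrightarrow>
    descendant T x z \<and> descendant T y z \<and>
    \<not> (\<exists>w. descendant T x w \<and> descendant T y w \<and> descendant T w z)"

text \<open>
  The next relation is only meant for \<open>x\<close> and \<open>y\<close> of which neither is a descendant of the other.
\<close>

definition right_of :: "planar_tree \<Rightarrow> nat \<Rightarrow> nat \<Rightarrow> bool"
  where "right_of T x y \<longleftrightarrow>
    (\<exists>z i j. first_common_ancestor T x y z \<and> in_child T z j x \<and> in_child T z i y \<and> j > i)"

text \<open>
  The cardinality \<open>#\<^sub>T(y,x)\<close> for \<open>x < y\<close>. In the last branch \<open>x\<close> is left of \<open>y\<close>.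
\<close>

definition cardinality :: "(nat \<Rightarrow> nat) \<Rightarrow> planar_tree \<Rightarrow> nat \<Rightarrow> nat \<Rightarrow> nat"
  where "cardinality s T y x =
    (if descendant T x y then (THE i. in_child T y i x)
     else if right_of T x y then s y
     else 0)"

definition inversions :: "nat \<Rightarrow> (nat \<Rightarrow> nat) \<Rightarrow> planar_tree \<Rightarrow> (nat \<times> nat) multiset"
  where "inversions n s T =
    (\<Sum>(y, x)\<in>{(y, x). 1 \<le> x \<and> x < y \<and> y \<le> n}. replicate_mset (cardinality s T y x) (y, x))"

lemma count_inversions:
  "count (inversions n s T) (y, x) = (if 1 \<le> x \<and> x < y \<and> y \<le> n then cardinality s T y x else 0)"
proof -
  have fin: "finite {(y, x). 1 \<le> x \<and> x < y \<and> y \<le> (n::nat)}"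
    by (rule finite_subset[of _ "{..n} \<times> {..n}"]) auto
  have "count (inversions n s T) (y, x) =
    (\<Sum>p\<in>{(y, x). 1 \<le> x \<and> x < y \<and> y \<le> n}. if p = (y, x) then cardinality s T y x else 0)"
    unfolding inversions_def count_sum by (rule sum.cong) (auto split: prod.splits)
  then show ?thesis
    using fin by (simp add: sum.delta)
qed


section \<open>The weak order and the Tamari lattice\<close>

definition s_weak_order :: "nat \<Rightarrow> (nat \<Rightarrow> nat) \<Rightarrow> planar_tree gorder"
  where "s_weak_order n s =
    \<lparr>carrier = decreasing_trees n s,
     eq = (=),
     le = (\<lambda>R T. \<forall>x y. 1 \<le> x \<and> x < y \<and> y \<le> n \<longrightarrow> cardinality s R y x \<le> cardinality s T y x)\<rparr>"

definition tamari_trees :: "nat \<Rightarrow> (nat \<Rightarrow> nat) \<Rightarrow> planar_tree set"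
  where "tamari_trees n s =
    {T \<in> decreasing_trees n s.
       \<forall>a b c. 1 \<le> a \<and> a < b \<and> b < c \<and> c \<le> n \<longrightarrow> cardinality s T c a \<le> cardinality s T c b}"

definition s_tamari_lattice :: "nat \<Rightarrow> (nat \<Rightarrow> nat) \<Rightarrow> planar_tree gorder"
  where "s_tamari_lattice n s = (s_weak_order n s)\<lparr>carrier := tamari_trees n s\<rparr>"


section \<open>The projections\<close>

definition pi_down :: "nat \<Rightarrow> (nat \<Rightarrow> nat) \<Rightarrow> planar_tree \<Rightarrow> planar_tree"
  where "pi_down n s T =
    (THE Q. Q \<in> decreasing_trees n s \<and>
       (\<forall>a c. 1 \<le> a \<and> a < c \<and> c \<le> n \<longrightarrow>
          cardinality s Q c a = Min {cardinality s T c b | b. a \<le> b \<and> b < c}))"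

definition pi_up :: "nat \<Rightarrow> (nat \<Rightarrow> nat) \<Rightarrow> planar_tree \<Rightarrow> planar_tree"
  where "pi_up n s T =
    (THE R. R \<in> decreasing_trees n s \<and>
       (\<forall>a c. 1 \<le> a \<and> a < c \<and> c \<le> n \<longrightarrow>
          cardinality s R c a =
            (if \<exists>b. a < b \<and> b < c \<and> cardinality s T b a = s b then s c
             else cardinality s T c a)))"

definition pi_down_equiv :: "nat \<Rightarrow> (nat \<Rightarrow> nat) \<Rightarrow> (planar_tree \<times> planar_tree) set"
  where "pi_down_equiv n s =
    {(T, T'). T \<in> decreasing_trees n s \<and> T' \<in> decreasing_trees n s \<and> pi_down n s T = pi_down n s T'}"

definition pi_up_equiv :: "nat \<Rightarrow> (nat \<Rightarrow> nat) \<Rightarrow> (planar_tree \<times> planar_tree) set"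
  where "pi_up_equiv n s =
    {(T, T'). T \<in> decreasing_trees n s \<and> T' \<in> decreasing_trees n s \<and> pi_up n s T = pi_up n s T'}"


section \<open>Rotations\<close>

definition inv_path :: "(nat \<times> nat) multiset \<Rightarrow> nat \<Rightarrow> nat \<Rightarrow> nat list \<Rightarrow> bool"
  where "inv_path I c a bs \<longleftrightarrow>
    2 \<le> length bs \<and> hd bs = c \<and> last bs = a \<and> sorted_wrt (>) bs \<and>
    (\<forall>i. Suc i < length bs \<longrightarrow> 0 < count I (bs ! i, bs ! Suc i))"

definition tc :: "(nat \<times> nat) multiset \<Rightarrow> (nat \<times> nat) multiset"
  where "tc I =
    Abs_multiset (\<lambda>(c, a). Max (insert 0 {count I (bs ! 0, bs ! 1) | bs. inv_path I c a bs}))"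

lemma count_tc:
  "count (tc I) (c, a) = Max (insert 0 {count I (bs ! 0, bs ! 1) | bs. inv_path I c a bs})"
proof -
  let ?S = "\<lambda>c a. {count I (bs ! 0, bs ! 1) | bs. inv_path I c a bs}"
  let ?f = "\<lambda>(c, a). Max (insert 0 (?S c a))"
  have "?S c a \<subseteq> {..size I}" for c a
    by (auto intro: count_le_size)
  then have fin: "finite (?S c a)" for c a
    by (rule finite_subset) simp
  have "(c, a) \<in> fst ` set_mset I \<times> snd ` set_mset I" if "0 < ?f (c, a)" for c a
  proof -
    obtain bs where bs: "inv_path I c a bs"
      using \<open>0 < ?f (c, a)\<close> fin[of c a] by (cases "?S c a = {}") auto
    define k where "k = length bs - 2"
    have len: "length bs = Suc (Suc k)"
      using bs by (auto simp: inv_path_def k_def)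
    have "bs ! 0 = c" "bs ! Suc k = a"
      using bs len by (auto simp: inv_path_def hd_conv_nth last_conv_nth simp flip: length_greater_0_conv)
    moreover have "(bs ! 0, bs ! Suc 0) \<in># I" "(bs ! k, bs ! Suc k) \<in># I"
      using bs len by (auto simp: inv_path_def)
    ultimately show ?thesis
      by force
  qed
  then have "{p. 0 < ?f p} \<subseteq> fst ` set_mset I \<times> snd ` set_mset I"
    by auto
  then have "finite {p. 0 < ?f p}"
    by (rule finite_subset) simp
  then show ?thesis
    unfolding tc_def by (subst count_Abs_multiset) auto
qed

definition tree_ascent :: "(nat \<Rightarrow> nat) \<Rightarrow> planar_tree \<Rightarrow> nat \<Rightarrow> nat \<Rightarrow> bool"
  where "tree_ascent s T a c \<longleftrightarrow>
    a < c \<and>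
    descendant T a c \<and>
    \<not> in_child T c (s c) a \<and>
    (\<forall>b. a < b \<and> b < c \<and> descendant T a b \<longrightarrow> in_child T b (s b) a) \<and>
    (0 < s a \<longrightarrow> \<not> (\<exists>x. in_child T a (s a) x))"

definition rotation :: "nat \<Rightarrow> (nat \<Rightarrow> nat) \<Rightarrow> nat \<Rightarrow> nat \<Rightarrow> planar_tree \<Rightarrow> planar_tree \<Rightarrow> bool"
  where "rotation n s a c T T' \<longleftrightarrow>
    T \<in> decreasing_trees n s \<and> T' \<in> decreasing_trees n s \<and> tree_ascent s T a c \<and>
    inversions n s T' = tc (add_mset (c, a) (inversions n s T))"

definition congruence_rotation :: "nat \<Rightarrow> (nat \<Rightarrow> nat) \<Rightarrow> planar_tree \<Rightarrow> planar_tree \<Rightarrow> bool"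
  where "congruence_rotation n s T T' \<longleftrightarrow>
    (\<exists>a c. rotation n s a c T T' \<and> (\<exists>b. a < b \<and> b < c \<and> cardinality s T b a = s b))"

definition rotation_equiv :: "nat \<Rightarrow> (nat \<Rightarrow> nat) \<Rightarrow> (planar_tree \<times> planar_tree) set"
  where "rotation_equiv n s =
    {(T, T'). T \<in> decreasing_trees n s \<and> T' \<in> decreasing_trees n s \<and>
              equivclp (congruence_rotation n s) T T'}"


section \<open>Lattice congruences and quotients\<close>

definition class_bottom :: "('a, 'b) gorder_scheme \<Rightarrow> ('a \<times> 'a) set \<Rightarrow> 'a \<Rightarrow> 'a"
  where "class_bottom L \<alpha> x = (THE l. least L l (\<alpha> `` {x}))"

definition class_top :: "('a, 'b) gorder_scheme \<Rightarrow> ('a \<times> 'a) set \<Rightarrow> 'a \<Rightarrow> 'a"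
  where "class_top L \<alpha> x = (THE u. greatest L u (\<alpha> `` {x}))"

definition lattice_congruence :: "('a, 'b) gorder_scheme \<Rightarrow> ('a \<times> 'a) set \<Rightarrow> bool"
  where "lattice_congruence L \<alpha> \<longleftrightarrow>
    lattice L \<and> finite (carrier L) \<and> equiv (carrier L) \<alpha> \<and>
    (\<forall>X \<in> carrier L // \<alpha>. \<exists>l\<in>carrier L. \<exists>u\<in>carrier L. X = \<lbrace>l..u\<rbrace>\<^bsub>L\<^esub>) \<and>
    isotone L L (class_bottom L \<alpha>) \<and> isotone L L (class_top L \<alpha>)"

definition quotient_order :: "('a, 'b) gorder_scheme \<Rightarrow> ('a \<times> 'a) set \<Rightarrow> 'a set gorder"
  where "quotient_order L \<alpha> =
    \<lparr>carrier = carrier L // \<alpha>,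
     eq = (=),
     le = (\<lambda>X Y. \<exists>x\<in>X. \<exists>y\<in>Y. x \<sqsubseteq>\<^bsub>L\<^esub> y)\<rparr>"

text \<open>\<open>join_pres\<close> and \<open>meet_pres\<close> include that both structures are lattices.\<close>

definition lattice_isomorphic :: "('a, 'c) gorder_scheme \<Rightarrow> ('b, 'd) gorder_scheme \<Rightarrow> bool"
  where "lattice_isomorphic L M \<longleftrightarrow>
    (\<exists>f. bij_betw f (carrier L) (carrier M) \<and> join_pres L M f \<and> meet_pres L M f)"

end

theory Submission
  imports Defs
begin

text \<open>
  A decreasing tree is determined by its cardinality function, and the functions that occur are
  those bounded by \<open>s\<close> and satisfying a transitivity and a planarity condition on triples
  \<open>a < b < c\<close>. In these terms \<open>\<pi>\<^sub>\<down>\<close> and \<open>\<pi>\<^sub>\<up>\<close> are order-preserving, lie below and above the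
  identity, and absorb each other: \<open>\<pi>\<^sub>\<down> \<circ> \<pi>\<^sub>\<up> = \<pi>\<^sub>\<down>\<close> and \<open>\<pi>\<^sub>\<up> \<circ> \<pi>\<^sub>\<down> = \<pi>\<^sub>\<up>\<close>. Hence they have the same
  fibres, the fibre of \<open>T\<close> is the interval from \<open>\<pi>\<^sub>\<down>(T)\<close> to \<open>\<pi>\<^sub>\<up>(T)\<close>, and the quotient is isomorphic to the
  fixed points of \<open>\<pi>\<^sub>\<down>\<close>, which are the Tamari trees. An \<open>s\<close>-congruence rotation of \<open>T\<close> stays below
  \<open>\<pi>\<^sub>\<up>(T)\<close>, because the function of \<open>\<pi>\<^sub>\<up>(T)\<close> is transitive; conversely, a tree with \<open>T \<noteq> \<pi>\<^sub>\<up>(T)\<close>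
  admits an \<open>s\<close>-congruence rotation, so finitely many of them lead from \<open>T\<close> to \<open>\<pi>\<^sub>\<up>(T)\<close>.
\<close>

section \<open>Trees and their cardinality functions\<close>

text \<open>This is \<open>decreasing_trees\<close> without the requirement on the label set: child
  subtrees carry arbitrary sets of labels, and the inductions over trees pass to them.\<close>

definition decreasing :: "(nat \<Rightarrow> nat) \<Rightarrow> planar_tree \<Rightarrow> bool"
  where "decreasing s T \<longleftrightarrow> distinct (labels T) \<and>
    (\<forall>y ts. Node y ts \<in> subtrees T \<longrightarrow>
       length ts = s y + 1 \<and> (\<forall>t\<in>set ts. \<forall>x\<in>set (labels t). x < y))"

lemma decreasing_trees_iff:
  "T \<in> decreasing_trees n s \<longleftrightarrow> decreasing s T \<and> set (labels T) = {1..n}"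
  by (auto simp: decreasing_trees_def decreasing_def)

lemma distinct_concat_iff_pairwise:
  "distinct (concat xss) \<longleftrightarrow>
    (\<forall>xs\<in>set xss. distinct xs) \<and> sorted_wrt (\<lambda>xs ys. set xs \<inter> set ys = {}) xss"
  by (induction xss) auto

lemma labels_subtree: "u \<in> subtrees t \<Longrightarrow> set (labels u) \<subseteq> set (labels t)"
  by (induction t) auto

lemma label_of_subtree: "Node y ts \<in> subtrees t \<Longrightarrow> y \<in> set (labels t)"
  using labels_subtree by fastforce

text \<open>Distinctness of a concatenation splits into distinctness of the parts and their pairwise
  disjointness. This recursive form is behind the inductions over trees.\<close>

lemma decreasing_Node:
  "decreasing s (Node m ts) \<longleftrightarrow>
    length ts = s m + 1 \<and> (\<forall>t\<in>set ts. decreasing s t \<and> (\<forall>x\<in>set (labels t). x < m)) \<and>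
    (\<forall>i<length ts. \<forall>j<length ts. i \<noteq> j \<longrightarrow> set (labels (ts ! i)) \<inter> set (labels (ts ! j)) = {})"
  (is "?L \<longleftrightarrow> ?R")
proof -
  \<comment> \<open>\<open>sorted_wrt\<close> only compares \<open>i < j\<close>; disjointness is
    symmetric, so this covers all pairs of distinct indices.\<close>
  have pw: "sorted_wrt (\<lambda>xs ys. set xs \<inter> set ys = {}) (map labels ts) \<longleftrightarrow>
    (\<forall>i<length ts. \<forall>j<length ts. i \<noteq> j \<longrightarrow> set (labels (ts ! i)) \<inter> set (labels (ts ! j)) = {})"
    (is "?A \<longleftrightarrow> ?B")
  proof
    assume ?A
    then have lt: "set (labels (ts ! i)) \<inter> set (labels (ts ! j)) = {}" if "i < j" "j < length ts" for i j
      using that by (simp add: sorted_wrt_iff_nth_less)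
    show ?B
    proof (intro allI impI)
      fix i j
      assume "i < length ts" "j < length ts" "i \<noteq> j"
      then show "set (labels (ts ! i)) \<inter> set (labels (ts ! j)) = {}"
        using lt[of i j] lt[of j i] by (cases i j rule: linorder_cases) (auto simp: Int_commute)
    qed
  qed (simp add: sorted_wrt_iff_nth_less)
  have all_Node: "(\<forall>y us. Node y us \<in> subtrees (Node m ts) \<longrightarrow> Q y us) \<longleftrightarrow>
    Q m ts \<and> (\<forall>t\<in>set ts. \<forall>y us. Node y us \<in> subtrees t \<longrightarrow> Q y us)" for Q
    by auto
  show ?thesis
    unfolding decreasing_def all_Node labels.simps distinct.simps distinct_concat_iff_pairwise pw
    by (simp add: ball_conj_distrib) blast
qed

lemma in_child_Leaf [simp]: "\<not> in_child Leaf y i x"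
  by (simp add: in_child_def)

lemma in_child_Node:
  "in_child (Node m ts) y i x \<longleftrightarrow>
    y = m \<and> i < length ts \<and> x \<in> set (labels (ts ! i)) \<or> (\<exists>t\<in>set ts. in_child t y i x)"
  by (auto simp: in_child_def)

lemma in_child_labels:
  assumes "in_child T y i x"
  shows "y \<in> set (labels T)" "x \<in> set (labels T)"
proof -
  obtain ts where ts: "Node y ts \<in> subtrees T" "i < length ts" "x \<in> set (labels (ts ! i))"
    using assms by (auto simp: in_child_def)
  then show "y \<in> set (labels T)"
    by (simp add: label_of_subtree)
  have "x \<in> set (labels (Node y ts))"
    using ts by force
  then show "x \<in> set (labels T)"
    using labels_subtree ts(1) by blast
qed

lemma in_child_less: "decreasing s T \<Longrightarrow> in_child T y i x \<Longrightarrow> x < y \<and> i \<le> s y"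
  unfolding decreasing_def in_child_def by (metis Suc_eq_plus1 less_Suc_eq_le nth_mem)

section \<open>Nodes and cardinalities seen from the root\<close>

context
  fixes s m ts
  assumes decr: "decreasing s (Node m ts)"
begin

lemma child_decreasing: "k < length ts \<Longrightarrow> decreasing s (ts ! k)"
  using decr by (auto simp: decreasing_Node)

lemma child_less: "k < length ts \<Longrightarrow> x \<in> set (labels (ts ! k)) \<Longrightarrow> x < m"
  using decr nth_mem by (fastforce simp: decreasing_Node)

lemma child_unique:
  "k < length ts \<Longrightarrow> j < length ts \<Longrightarrow> x \<in> set (labels (ts ! k)) \<Longrightarrow> x \<in> set (labels (ts ! j)) \<Longrightarrow> k = j"
  using decr by (fastforce simp: decreasing_Node)

lemma in_child_root: "in_child (Node m ts) m i x \<longleftrightarrow> i < length ts \<and> x \<in> set (labels (ts ! i))"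
proof -
  have "\<not> in_child t m i x" if "t \<in> set ts" for t
    using in_child_labels(1) that child_less by (metis in_set_conv_nth less_irrefl)
  then show ?thesis
    by (auto simp: in_child_Node)
qed

lemma in_child_below:
  assumes "k < length ts" "y \<in> set (labels (ts ! k))"
  shows "in_child (Node m ts) y i x \<longleftrightarrow> in_child (ts ! k) y i x"
proof -
  have "t = ts ! k" if "t \<in> set ts" "in_child t y i x" for t
    using that assms child_unique in_child_labels(1) by (metis in_set_conv_nth)
  then show ?thesis
    using assms child_less[OF assms] by (auto simp: in_child_Node)
qed

lemma descendant_root:
  "descendant (Node m ts) x m \<longleftrightarrow> (\<exists>k<length ts. x \<in> set (labels (ts ! k)))"
  by (auto simp: descendant_def in_child_root)

lemma descendant_below:
  assumes "k < length ts" "y \<in> set (labels (ts ! k))"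
  shows "descendant (Node m ts) x y \<longleftrightarrow> descendant (ts ! k) x y"
  by (simp add: descendant_def in_child_below[OF assms])

lemma descendant_below_label:
  assumes "k < length ts" "y \<in> set (labels (ts ! k))" "descendant (Node m ts) x y"
  shows "x \<in> set (labels (ts ! k))"
  using assms descendant_below in_child_labels(2) by (metis descendant_def)

text \<open>The child containing \<open>x\<close> is unique, so an ancestor of \<open>x\<close>
  other than the root has to lie in that child.\<close>

lemma ancestor_cases:
  assumes "descendant (Node m ts) x z" "k < length ts" "x \<in> set (labels (ts ! k))"
  shows "z = m \<or> z \<in> set (labels (ts ! k)) \<and> descendant (ts ! k) x z"
proof (cases "z = m")
  case False
  obtain i where "in_child (Node m ts) z i x"
    using assms by (auto simp: descendant_def)
  then obtain t where t: "t \<in> set ts" "in_child t z i x"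
    using False by (auto simp: in_child_Node)
  then have "t = ts ! k"
    using assms child_unique in_child_labels(2) by (metis in_set_conv_nth)
  then show ?thesis
    using t in_child_labels(1) by (auto simp: descendant_def)
qed simp

text \<open>The root has both nodes in the same child, so it cannot supply two different indices.
  Any other common ancestor lies in the \<open>k\<close>-th child, and being the first one means the
  same there as in the whole tree.\<close>

lemma right_of_same:
  assumes k: "k < length ts" and x: "x \<in> set (labels (ts ! k))" and y: "y \<in> set (labels (ts ! k))"
  shows "right_of (Node m ts) x y \<longleftrightarrow> right_of (ts ! k) x y"
proof
  assume "right_of (Node m ts) x y"
  then obtain z i j where z: "first_common_ancestor (Node m ts) x y z"
    "in_child (Node m ts) z j x" "in_child (Node m ts) z i y" "j > i"
    by (auto simp: right_of_def)
  have "z \<noteq> m"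
    using z(2-4) k x y child_unique by (metis in_child_root less_irrefl)
  then have zk: "z \<in> set (labels (ts ! k))"
    using z(1) ancestor_cases[OF _ k x] by (auto simp: first_common_ancestor_def)
  have "first_common_ancestor (ts ! k) x y z"
    using z(1) k zk descendant_below in_child_labels(1)
    unfolding first_common_ancestor_def by (metis descendant_def)
  then show "right_of (ts ! k) x y"
    using z zk k in_child_below unfolding right_of_def by blast
next
  assume "right_of (ts ! k) x y"
  then obtain z i j where z: "first_common_ancestor (ts ! k) x y z"
    "in_child (ts ! k) z j x" "in_child (ts ! k) z i y" "j > i"
    by (auto simp: right_of_def)
  have zk: "z \<in> set (labels (ts ! k))"
    using z(2) in_child_labels(1) by blast
  have "first_common_ancestor (Node m ts) x y z"
    using z(1) zk k descendant_below descendant_below_label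
    unfolding first_common_ancestor_def by (metis)
  then show "right_of (Node m ts) x y"
    using z zk k in_child_below unfolding right_of_def by blast
qed

text \<open>Nodes from different children have only the root as a common ancestor.\<close>

lemma right_of_diff:
  assumes i: "i < length ts" "y \<in> set (labels (ts ! i))" and j: "j < length ts" "x \<in> set (labels (ts ! j))"
    and "i \<noteq> j"
  shows "right_of (Node m ts) x y \<longleftrightarrow> i < j"
proof -
  have anc: "z = m" if "descendant (Node m ts) x z" "descendant (Node m ts) y z" for z
    using ancestor_cases[OF that(1) j] ancestor_cases[OF that(2) i] child_unique i j \<open>i \<noteq> j\<close> by blast
  have "\<not> descendant (Node m ts) m m"
    using child_less by (auto simp: descendant_root)
  moreover have "descendant (Node m ts) x m" "descendant (Node m ts) y m"
    using i j by (auto simp: descendant_root)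
  ultimately have fca: "first_common_ancestor (Node m ts) x y z \<longleftrightarrow> z = m" for z
    using anc unfolding first_common_ancestor_def by blast
  have "in_child (Node m ts) m k x \<longleftrightarrow> k = j" "in_child (Node m ts) m k y \<longleftrightarrow> k = i" for k
    using i j child_unique by (auto simp: in_child_root)
  then show ?thesis
    by (simp add: right_of_def fca)
qed

text \<open>Together with the next two lemmas this computes \<open>cardinality\<close> by recursion,
  so that later inductions need not mention common ancestors.\<close>

lemma cardinality_root:
  assumes "k < length ts" "x \<in> set (labels (ts ! k))"
  shows "cardinality s (Node m ts) m x = k"
proof -
  have "in_child (Node m ts) m i x \<longleftrightarrow> i = k" for i
    using assms child_unique by (auto simp: in_child_root)
  then have "(THE i. in_child (Node m ts) m i x) = k"
    by simp
  then show ?thesis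
    using assms by (auto simp: cardinality_def descendant_root)
qed

lemma cardinality_same:
  assumes "k < length ts" "x \<in> set (labels (ts ! k))" "y \<in> set (labels (ts ! k))"
  shows "cardinality s (Node m ts) y x = cardinality s (ts ! k) y x"
  by (simp add: cardinality_def descendant_below[OF assms(1,3)] in_child_below[OF assms(1,3)]
      right_of_same[OF assms])

lemma cardinality_diff:
  assumes "i < length ts" "y \<in> set (labels (ts ! i))" "j < length ts" "x \<in> set (labels (ts ! j))" "i \<noteq> j"
  shows "cardinality s (Node m ts) y x = (if i < j then s y else 0)"
proof -
  have "\<not> descendant (Node m ts) x y"
    using assms descendant_below_label child_unique by blast
  then show ?thesis
    by (simp add: cardinality_def right_of_diff[OF assms])
qed

lemma labels_cases:
  assumes "x \<in> set (labels (Node m ts))"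
  obtains "x = m" | k where "k < length ts" "x \<in> set (labels (ts ! k))"
  using assms by (auto simp: in_set_conv_nth[of _ ts])

lemma label_le_root: "x \<in> set (labels (Node m ts)) \<Longrightarrow> x \<le> m"
  by (erule labels_cases) (auto dest: child_less)

lemma label_child:
  assumes "x \<in> set (labels (Node m ts))" "x < m"
  obtains k where "k < length ts" "x \<in> set (labels (ts ! k))"
  using assms labels_cases by blast

text \<open>The label sets of the children are the level sets of the function at the greatest label;
  this is what makes a tree recoverable from its function.\<close>

lemma child_labels_eq:
  assumes "k < length ts"
  shows "set (labels (ts ! k)) =
    {x \<in> set (labels (Node m ts)). x < m \<and> cardinality s (Node m ts) m x = k}" (is "?L = ?R")
proof
  show "?L \<subseteq> ?R"
    using assms child_less cardinality_root by auto
  show "?R \<subseteq> ?L"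
  proof
    fix x
    assume "x \<in> ?R"
    then obtain j where "j < length ts" "x \<in> set (labels (ts ! j))"
      using label_child by blast
    with \<open>x \<in> ?R\<close> show "x \<in> ?L"
      using cardinality_root by auto
  qed
qed

lemma length_children: "length ts = Suc (s m)"
  using decr by (simp add: decreasing_Node)

end

text \<open>
  The two conditions on triples are called transitivity and planarity in the literature on the
  \<open>s\<close>-weak order.
\<close>

definition tree_inversion :: "nat set \<Rightarrow> (nat \<Rightarrow> nat) \<Rightarrow> (nat \<Rightarrow> nat \<Rightarrow> nat) \<Rightarrow> bool"
  where "tree_inversion S s f \<longleftrightarrow>
    (\<forall>a\<in>S. \<forall>c\<in>S. a < c \<longrightarrow> f c a \<le> s c) \<and>
    (\<forall>a\<in>S. \<forall>b\<in>S. \<forall>c\<in>S. a < b \<longrightarrow> b < c \<longrightarrow> 0 < f b a \<longrightarrow> f c b \<le> f c a) \<and>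
    (\<forall>a\<in>S. \<forall>b\<in>S. \<forall>c\<in>S. a < b \<longrightarrow> b < c \<longrightarrow> f b a < s b \<longrightarrow> f c a \<le> f c b)"

section \<open>Cardinality functions of trees\<close>

lemma cardinality_le:
  "decreasing s T \<Longrightarrow> x \<in> set (labels T) \<Longrightarrow> y \<in> set (labels T) \<Longrightarrow> x < y \<Longrightarrow> cardinality s T y x \<le> s y"
proof (induction T)
  case (Node m ts)
  note d = \<open>decreasing s (Node m ts)\<close>
  from d Node.prems(2) show ?case
  proof (cases rule: labels_cases)
    case 1
    with Node.prems child_less[OF d] show ?thesis
      by (metis labels_cases less_asym order_refl)
  next
    case (2 j)
    from d Node.prems(3) show ?thesis
    proof (cases rule: labels_cases)
      case 1
      with 2 show ?thesis
        using cardinality_root[OF d 2] length_children[OF d] by simp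
    next
      case (2 i)
      show ?thesis
      proof (cases "i = j")
        case True
        then show ?thesis
          using Node.IH[of "ts ! i"] Node.prems(4) child_decreasing[OF d] 2 \<open>j < length ts\<close>
            \<open>x \<in> set (labels (ts ! j))\<close> cardinality_same[OF d] by auto
      next
        case False
        then show ?thesis
          using cardinality_diff[OF d 2 \<open>j < length ts\<close> \<open>x \<in> set (labels (ts ! j))\<close>] by simp
      qed
    qed
  qed
qed simp

text \<open>Below the root, \<open>a\<close> and \<open>b\<close> lie in children \<open>i\<close>
  and \<open>j\<close>. If \<open>c\<close> is the root, comparing \<open>i\<close> with
  \<open>j\<close> decides; if all three nodes share a child, the induction hypothesis applies;
  otherwise the order of the children decides.\<close>

lemma tree_inversion_cardinality: "decreasing s T \<Longrightarrow> tree_inversion (set (labels T)) s (cardinality s T)"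
proof (induction T)
  case (Node m ts)
  note d = \<open>decreasing s (Node m ts)\<close>
  let ?f = "cardinality s (Node m ts)"
  let ?S = "set (labels (Node m ts))"
  have tr: "(0 < ?f b a \<longrightarrow> ?f c b \<le> ?f c a) \<and> (?f b a < s b \<longrightarrow> ?f c a \<le> ?f c b)"
    if S: "a \<in> ?S" "b \<in> ?S" "c \<in> ?S" and "a < b" "b < c" for a b c
  proof -
    have "a < m" "b < m"
      using label_le_root[OF d S(3)] \<open>a < b\<close> \<open>b < c\<close> by auto
    then obtain i j where i: "i < length ts" "a \<in> set (labels (ts ! i))"
      and j: "j < length ts" "b \<in> set (labels (ts ! j))"
      using label_child[OF d] S by metis
    have ba: "?f b a = (if i = j then cardinality s (ts ! i) b a else if j < i then s b else 0)"
      using cardinality_same[OF d] cardinality_diff[OF d j i] i j by auto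
    from d S(3) show ?thesis
    proof (cases rule: labels_cases)
      case 1
      then show ?thesis
        using cardinality_root[OF d i] cardinality_root[OF d j] ba by auto
    next
      case (2 k)
      have ca: "?f c a = (if i = k then cardinality s (ts ! k) c a else if k < i then s c else 0)"
        using cardinality_same[OF d] cardinality_diff[OF d 2 i] i 2 by auto
      have cb: "?f c b = (if j = k then cardinality s (ts ! k) c b else if k < j then s c else 0)"
        using cardinality_same[OF d] cardinality_diff[OF d 2 j] j 2 by auto
      \<comment> \<open>Needed when only one of \<open>a\<close>, \<open>b\<close> shares the child
        of \<open>c\<close>: its value at \<open>c\<close> is then arbitrary and is compared with 0
        or \<open>s c\<close>.\<close>
      have bd: "?f c a \<le> s c" "?f c b \<le> s c"
        using cardinality_le[OF d] S \<open>a < b\<close> \<open>b < c\<close> by auto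
      show ?thesis
      proof (cases "i = j \<and> j = k")
        case True
        then have "tree_inversion (set (labels (ts ! k))) s (cardinality s (ts ! k))"
          using Node.IH[of "ts ! k"] child_decreasing[OF d] 2 by simp
        then show ?thesis
          using True ba ca cb i j 2 \<open>a < b\<close> \<open>b < c\<close> unfolding tree_inversion_def by auto
      next
        case False
        then show ?thesis
          using ba ca cb bd by (auto split: if_splits)
      qed
    qed
  qed
  show ?case
    unfolding tree_inversion_def using cardinality_le[OF d] tr by blast
qed (simp add: tree_inversion_def)

text \<open>A node having \<open>a\<close> and \<open>c\<close> in different children separates them
  by its values, whereas nodes outside a common child cannot tell them apart. Descent thereby
  becomes a condition on the function alone.\<close>

lemma descendant_iff_cardinality:
  "decreasing s T \<Longrightarrow> a \<in> set (labels T) \<Longrightarrow> c \<in> set (labels T) \<Longrightarrow> a < c \<Longrightarrow>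
    descendant T a c \<longleftrightarrow>
      (\<forall>d\<in>set (labels T). c < d \<longrightarrow> cardinality s T d a = cardinality s T d c)"
proof (induction T)
  case (Node m ts)
  note d = \<open>decreasing s (Node m ts)\<close>
  let ?f = "cardinality s (Node m ts)"
  note le = label_le_root[OF d]
  obtain i where i: "i < length ts" "a \<in> set (labels (ts ! i))"
    using Node.prems le label_child[OF d] by (metis less_le_trans)
  from d Node.prems(3) show ?case
  proof (cases rule: labels_cases)
    case 1
    then show ?thesis
      using i le by (auto simp: descendant_root[OF d] simp del: labels.simps dest: leD)
  next
    case (2 k)
    show ?thesis
    proof (cases "i = k")
      case False
      moreover have "\<not> descendant (Node m ts) a c"
        using False i 2 descendant_below_label[OF d] child_unique[OF d] by blast
      ultimately show ?thesis
        using cardinality_root[OF d i] cardinality_root[OF d 2] child_less[OF d 2] by auto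
    next
      case True
      have other: "?f y a = ?f y c"
        if "y \<in> set (labels (Node m ts))" "y \<notin> set (labels (ts ! k))" for y
        using d that(1)
      proof (cases rule: labels_cases)
        case 1
        then show ?thesis
          using cardinality_root[OF d] i 2 True by simp
      next
        case (2 l)
        then have "l \<noteq> k"
          using that by blast
        then show ?thesis
          using cardinality_diff[OF d 2] i True \<open>c \<in> set (labels (ts ! k))\<close> by auto
      qed
      have "descendant (Node m ts) a c \<longleftrightarrow> descendant (ts ! k) a c"
        using descendant_below[OF d 2] .
      also have "\<dots> \<longleftrightarrow> (\<forall>y\<in>set (labels (ts ! k)). c < y \<longrightarrow> cardinality s (ts ! k) y a = cardinality s (ts ! k) y c)"
        using Node.IH[of "ts ! k"] child_decreasing[OF d] i 2 True \<open>a < c\<close> by simp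
      also have "\<dots> \<longleftrightarrow> (\<forall>y\<in>set (labels (ts ! k)). c < y \<longrightarrow> ?f y a = ?f y c)"
        using cardinality_same[OF d] i 2 True by auto
      also have "\<dots> \<longleftrightarrow> (\<forall>y\<in>set (labels (Node m ts)). c < y \<longrightarrow> ?f y a = ?f y c)"
        using other 2(1) by auto
      finally show ?thesis .
    qed
  qed
qed simp

lemma in_child_unique: "decreasing s T \<Longrightarrow> in_child T y i x \<Longrightarrow> in_child T y j x \<Longrightarrow> i = j"
proof (induction T)
  case (Node m ts)
  note d = \<open>decreasing s (Node m ts)\<close>
  have "y \<in> set (labels (Node m ts))"
    using Node.prems in_child_labels(1) by blast
  with d show ?case
  proof (cases rule: labels_cases)
    case 1
    then show ?thesis
      using Node.prems child_unique[OF d] by (auto simp: in_child_root[OF d])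
  next
    case (2 k)
    then show ?thesis
      using Node.IH[of "ts ! k"] Node.prems child_decreasing[OF d] in_child_below[OF d 2] by auto
  qed
qed simp

lemma in_child_iff_cardinality:
  "decreasing s T \<Longrightarrow> in_child T y i x \<longleftrightarrow> descendant T x y \<and> cardinality s T y x = i"
  using in_child_unique[of s T y _ x] by (auto simp: descendant_def cardinality_def intro: the_equality theI2)

section \<open>Trees correspond to tree inversions\<close>

lemma decreasing_eqI:
  "decreasing s T \<Longrightarrow> decreasing s T' \<Longrightarrow> set (labels T) = set (labels T') \<Longrightarrow>
    (\<And>x y. x \<in> set (labels T) \<Longrightarrow> y \<in> set (labels T) \<Longrightarrow> x < y \<Longrightarrow>
      cardinality s T y x = cardinality s T' y x) \<Longrightarrow> T = T'"
proof (induction T arbitrary: T')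
  case Leaf
  then show ?case
    by (cases T') auto
next
  case (Node m ts)
  obtain m' ts' where T': "T' = Node m' ts'"
    using Node.prems by (cases T') auto
  note d = \<open>decreasing s (Node m ts)\<close>
  note d' = Node.prems(2)[unfolded T']
  note le = label_le_root[OF d]
  note le' = label_le_root[OF d']
  \<comment> \<open>Both roots are the greatest label of the common label set.\<close>
  have m: "m' = m"
    using le[of m'] le'[of m] Node.prems(3) T' by (metis label_of_subtree le_antisym insertI1 subtrees.simps(2))
  note d' = d'[unfolded m] and T' = T'[unfolded m]
  have eq: "cardinality s (Node m ts) y x = cardinality s (Node m ts') y x"
    if "x \<in> set (labels (Node m ts))" "y \<in> set (labels (Node m ts))" "x < y" for x y
    using Node.prems(4)[OF that] T' by simp
  have labs: "set (labels (ts ! k)) = {x \<in> set (labels (Node m ts)). x < m \<and> cardinality s (Node m ts) m x = k}"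
    if "k < length ts" for k
    using child_labels_eq[OF d that] .
  have labs': "set (labels (ts' ! k)) = {x \<in> set (labels (Node m ts')). x < m \<and> cardinality s (Node m ts') m x = k}"
    if "k < length ts'" for k
    using child_labels_eq[OF d' that] .
  have same: "set (labels (Node m ts)) = set (labels (Node m ts'))"
    using Node.prems(3) T' by simp
  have m_in: "m \<in> set (labels (Node m ts))"
    by simp
  have len: "length ts' = length ts"
    using length_children[OF d] length_children[OF d'] by simp
  have "ts ! k = ts' ! k" if k: "k < length ts" for k
  proof (rule Node.IH)
    have k': "k < length ts'"
      using k len by simp
    show "ts ! k \<in> set ts" "decreasing s (ts ! k)" "decreasing s (ts' ! k)"
      using k k' child_decreasing[OF d] child_decreasing[OF d'] by auto
    \<comment> \<open>Both sides are the level set of the value \<open>k\<close> at the root, where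
      the two functions agree.\<close>
    show l: "set (labels (ts ! k)) = set (labels (ts' ! k))"
      unfolding labs[OF k] labs'[OF k'] same[symmetric] using eq[OF _ m_in]
      by (auto simp del: labels.simps)
    show "cardinality s (ts ! k) y x = cardinality s (ts' ! k) y x"
      if "x \<in> set (labels (ts ! k))" "y \<in> set (labels (ts ! k))" "x < y" for x y
      using eq[of x y] cardinality_same[OF d k, of x y] cardinality_same[OF d' k', of x y] that l
        labs[OF k] by auto
  qed
  then show ?case
    using len T' by (simp add: list_eq_iff_nth_eq)
qed

lemma tree_inversion_subset: "tree_inversion S s f \<Longrightarrow> R \<subseteq> S \<Longrightarrow> tree_inversion R s f"
  unfolding tree_inversion_def by (meson subsetD)

text \<open>The greatest element of \<open>S\<close> becomes the root, the level sets of
  \<open>f\<close> at it become the label sets of the children, and induction on the set supplies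
  the children themselves.\<close>

lemma ex_decreasing_cardinality:
  "finite S \<Longrightarrow> tree_inversion S s f \<Longrightarrow>
    \<exists>T. decreasing s T \<and> set (labels T) = S \<and> (\<forall>x\<in>S. \<forall>y\<in>S. x < y \<longrightarrow> cardinality s T y x = f y x)"
proof (induction S rule: finite_psubset_induct)
  case (psubset S)
  show ?case
  proof (cases "S = {}")
    case True
    then show ?thesis
      by (intro exI[of _ Leaf]) (simp add: decreasing_def)
  next
    case False
    define m where "m = Max S"
    have m: "m \<in> S" "\<And>x. x \<in> S \<Longrightarrow> x \<le> m"
      using False psubset.hyps by (auto simp: m_def)
    define C where "C i = {x \<in> S. x < m \<and> f m x = i}" for i
    have "\<exists>T. decreasing s T \<and> set (labels T) = C i \<and> (\<forall>x\<in>C i. \<forall>y\<in>C i. x < y \<longrightarrow> cardinality s T y x = f y x)" for i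
      using m by (intro psubset.IH tree_inversion_subset[OF psubset.prems]) (auto simp: C_def)
    then obtain t where t: "\<And>i. decreasing s (t i)" "\<And>i. set (labels (t i)) = C i"
      "\<And>i x y. x \<in> C i \<Longrightarrow> y \<in> C i \<Longrightarrow> x < y \<Longrightarrow> cardinality s (t i) y x = f y x"
      by metis
    define ts where "ts = map t [0..<Suc (s m)]"
    have len: "length ts = Suc (s m)" and nth: "\<And>i. i < Suc (s m) \<Longrightarrow> ts ! i = t i"
      by (auto simp: ts_def simp del: upt_Suc)
    have set_ts: "set ts = t ` {..s m}"
      by (auto simp: ts_def simp del: upt_Suc)
    have d: "decreasing s (Node m ts)"
      unfolding decreasing_Node using len nth t(1) by (auto simp: set_ts t(2)) (auto simp: C_def)
    have idx: "f m x < Suc (s m) \<and> x \<in> C (f m x)" if "x \<in> S" "x < m" for x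
      using psubset.prems m that unfolding tree_inversion_def by (auto simp: C_def less_Suc_eq_le)
    have "set (labels (Node m ts)) = insert m (\<Union>i\<le>s m. C i)"
      by (simp add: set_ts t(2))
    also have "\<dots> = S"
      using m idx le_neq_implies_less by (fastforce simp: C_def less_Suc_eq_le)
    finally have labs: "set (labels (Node m ts)) = S" .
    have "cardinality s (Node m ts) y x = f y x" if xy: "x \<in> S" "y \<in> S" "x < y" for x y
    proof -
      have x: "f m x < length ts" "x \<in> set (labels (ts ! (f m x)))"
        using idx[of x] xy m(2)[of y] len nth t(2) by auto
      show ?thesis
      proof (cases "y = m")
        case True
        then show ?thesis
          using cardinality_root[OF d x] by simp
      next
        case False
        then have "y < m"
          using m(2) xy(2) by fastforce
        then have y: "f m y < length ts" "y \<in> set (labels (ts ! (f m y)))"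
          using idx[of y] xy len nth t(2) by auto
        show ?thesis
        proof (cases "f m x = f m y")
          case True
          then show ?thesis
            using cardinality_same[OF d x, of y] x y t(2) t(3)[of x "f m x" y] len nth xy(3) by auto
        next
          case False
          \<comment> \<open>With \<open>m\<close> on top, transitivity and planarity leave for
            \<open>x\<close> and \<open>y\<close> in different children only the value 0 or
            \<open>s y\<close>, according to the order of these children.\<close>
          have "0 < f y x \<Longrightarrow> f m y \<le> f m x" "f y x < s y \<Longrightarrow> f m x \<le> f m y" "f y x \<le> s y"
            using psubset.prems xy m(1) \<open>y < m\<close> unfolding tree_inversion_def by blast+
          then show ?thesis
            using cardinality_diff[OF d y x] False by (cases "f m x < f m y") force+
        qed
      qed
    qed
    then show ?thesis
      using d labs by blast
  qed
qed

section \<open>Transitive closure along descending paths\<close>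

text \<open>A path in the sense of \<open>inv_path\<close>, grown at its lower end; the last
  argument keeps the value of the first edge, over which \<open>tc\<close> maximises.\<close>

inductive walk :: "(nat \<Rightarrow> nat \<Rightarrow> nat) \<Rightarrow> nat \<Rightarrow> nat \<Rightarrow> nat \<Rightarrow> bool" for g c
  where
    walk_edge: "a < c \<Longrightarrow> 0 < g c a \<Longrightarrow> walk g c a (g c a)"
  | walk_step: "walk g c b i \<Longrightarrow> a < b \<Longrightarrow> 0 < g b a \<Longrightarrow> walk g c a i"

definition walk_max :: "(nat \<Rightarrow> nat \<Rightarrow> nat) \<Rightarrow> nat \<Rightarrow> nat \<Rightarrow> nat"
  where "walk_max g c a = Max (insert 0 {i. walk g c a i})"

lemma walk_less: "walk g c a i \<Longrightarrow> a < c"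
  by (induction rule: walk.induct) auto

lemma walk_first_edge: "walk g c a i \<Longrightarrow> \<exists>b<c. i = g c b"
  by (induction rule: walk.induct) auto

lemma walk_trans: "walk g b a j \<Longrightarrow> walk g c b i \<Longrightarrow> walk g c a i"
  by (induction rule: walk.induct) (auto intro: walk_step)

lemma finite_walk: "finite {i. walk g c a i}"
  by (rule finite_subset[of _ "g c ` {..<c}"]) (auto dest: walk_first_edge)

lemma walk_le_walk_max: "walk g c a i \<Longrightarrow> i \<le> walk_max g c a"
  by (simp add: walk_max_def finite_walk)

lemma walk_walk_max: "0 < walk_max g c a \<Longrightarrow> walk g c a (walk_max g c a)"
  using Max_in[of "insert 0 {i. walk g c a i}"] finite_walk[of g c a] by (auto simp: walk_max_def)

lemma walk_max_ge: "a < c \<Longrightarrow> g c a \<le> walk_max g c a"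
  by (cases "g c a = 0") (auto intro: walk_le_walk_max walk_edge)

text \<open>An optimal walk from \<open>c\<close> to \<open>b\<close>, prolonged by a walk from
  \<open>b\<close> to \<open>a\<close>, keeps its first edge.\<close>

lemma walk_max_transitive: "0 < walk_max g b a \<Longrightarrow> walk_max g c b \<le> walk_max g c a"
  by (cases "walk_max g c b = 0") (auto intro: walk_le_walk_max walk_trans walk_walk_max)

text \<open>Transitivity of \<open>h\<close> carries the value of the first edge along the walk. So
  the closure of \<open>g\<close> stays below every tree inversion that dominates \<open>g\<close>,
  which serves both the joins and the rotations.\<close>

lemma walk_le:
  assumes "\<And>a c. 0 < g c a \<Longrightarrow> a < c \<Longrightarrow> a \<in> S \<and> c \<in> S"
    and le: "\<And>a c. a \<in> S \<Longrightarrow> c \<in> S \<Longrightarrow> a < c \<Longrightarrow> g c a \<le> h c a"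
    and h: "tree_inversion S s h"
  shows "walk g c a i \<Longrightarrow> i \<le> h c a"
proof (induction rule: walk.induct)
  case (walk_edge a)
  then show ?case
    using assms by blast
next
  case (walk_step b i a)
  then have "a \<in> S" "b \<in> S"
    using assms(1) by blast+
  moreover have "c \<in> S"
    using walk_step.hyps(1) by (induction rule: walk.induct) (use assms(1) in blast)+
  moreover have "0 < h b a"
    using le[OF \<open>a \<in> S\<close> \<open>b \<in> S\<close>] walk_step by simp
  ultimately have "h c b \<le> h c a"
    using h walk_step(2) walk_less[OF walk_step(1)] unfolding tree_inversion_def by blast
  then show ?case
    using walk_step.IH by simp
qed

lemma walk_max_le:
  assumes "\<And>a c. 0 < g c a \<Longrightarrow> a < c \<Longrightarrow> a \<in> S \<and> c \<in> S"
    and "\<And>a c. a \<in> S \<Longrightarrow> c \<in> S \<Longrightarrow> a < c \<Longrightarrow> g c a \<le> h c a"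
    and "tree_inversion S s h"
  shows "walk_max g c a \<le> h c a"
  using walk_le[of g S h s c a "walk_max g c a", OF assms] walk_walk_max[of g c a] by (cases "walk_max g c a = 0") auto

text \<open>The point is that planarity, assumed for single entries, survives the closure. A walk
  from \<open>c\<close> to \<open>a\<close> either meets \<open>b\<close> or has an edge that jumps
  over \<open>b\<close>; planarity of that edge redirects the walk to \<open>b\<close> or yields a
  full edge from \<open>b\<close> back onto the walk.\<close>

lemma tree_inversion_walk_max:
  assumes edge: "\<And>a c. 0 < g c a \<Longrightarrow> a < c \<Longrightarrow> a \<in> S \<and> c \<in> S \<and> g c a \<le> s c"
    and planar: "\<And>a b c. a \<in> S \<Longrightarrow> b \<in> S \<Longrightarrow> c \<in> S \<Longrightarrow> a < b \<Longrightarrow> b < c \<Longrightarrow> 0 < g c a \<Longrightarrow>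
      s b \<le> g b a \<or> g c a \<le> g c b"
    and pos: "\<And>b. b \<in> S \<Longrightarrow> 0 < s b"
  shows "tree_inversion S s (walk_max g)"
proof -
  \<comment> \<open>Positivity of \<open>s b\<close> makes an entry of size at least
    \<open>s b\<close> an edge.\<close>
  have planar_edge: "walk g b a (g b a) \<and> s b \<le> g b a \<or> walk g c b (g c b) \<and> g c a \<le> g c b"
    if "b \<in> S" "a < b" "b < c" "0 < g c a" for a b c
  proof -
    have "a \<in> S" "c \<in> S"
      using edge[of c a] that by auto
    then show ?thesis
      using planar[of a b c] pos[of b] that by (auto intro!: walk_edge)
  qed
  \<comment> \<open>The value may grow when the first edge itself is replaced, hence some
    \<open>j \<ge> i\<close>.\<close>
  have walk_planar: "(\<exists>j\<ge>i. walk g c b j) \<or> (\<exists>j\<ge>s b. walk g b a j)"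
    if "walk g c a i" "b \<in> S" "a < b" "b < c" for a b c i
    using that
  proof (induction rule: walk.induct)
    case (walk_edge a)
    then show ?case
      using planar_edge by blast
  next
    case (walk_step b' i a)
    \<comment> \<open>\<open>b'\<close> is the upper end of the last edge: the walk has reached
      \<open>b\<close>, jumps over it with this edge, or is already below it.\<close>
    consider "b' = b" | "b < b'" | "b' < b"
      by linarith
    then show ?case
    proof cases
      case 1
      then show ?thesis
        using walk_step.hyps by blast
    next
      case 2
      from planar_edge[OF walk_step.prems(1,2) this walk_step.hyps(3)] show ?thesis
      proof
        assume "walk g b' b (g b' b) \<and> g b' a \<le> g b' b"
        then have "walk g c b i"
          using walk_trans walk_step.hyps(1) by blast
        then show ?thesis
          by blast
      qed blast
    next
      case 3
      from walk_step.IH[OF walk_step.prems(1) 3 walk_step.prems(3)] show ?thesis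
        using walk_step.hyps(2,3) walk.walk_step by blast
    qed
  qed
  show ?thesis
    unfolding tree_inversion_def
  proof (intro conjI ballI impI)
    show "walk_max g c a \<le> s c" for a c
      using walk_walk_max[of g c a] walk_first_edge[of g c a "walk_max g c a"] edge
      by (cases "walk_max g c a = 0") auto
    show "walk_max g c b \<le> walk_max g c a" if "0 < walk_max g b a" for a b c
      using that by (rule walk_max_transitive)
    show "walk_max g c a \<le> walk_max g c b"
      if "b \<in> S" "a < b" "b < c" "walk_max g b a < s b" for a b c
    proof (cases "walk_max g c a = 0")
      case False
      then have "(\<exists>j\<ge>walk_max g c a. walk g c b j) \<or> (\<exists>j\<ge>s b. walk g b a j)"
        using walk_planar walk_walk_max that by blast
      then show ?thesis
        using walk_le_walk_max[of g c b] walk_le_walk_max[of g b a] that(4) by fastforce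
    qed simp
  qed
qed

section \<open>Agreement with the closure \<open>tc\<close>\<close>

lemma walk_iff_inv_path:
  "walk (\<lambda>y x. count I (y, x)) c a i \<longleftrightarrow> (\<exists>bs. inv_path I c a bs \<and> i = count I (bs ! 0, bs ! 1))"
  (is "?W a i \<longleftrightarrow> _")
proof
  assume "?W a i"
  \<comment> \<open>The extra bound on the entries lets \<open>bs @ [a]\<close> remain strictly
    descending.\<close>
  then have "\<exists>bs. inv_path I c a bs \<and> (\<forall>x\<in>set bs. a \<le> x) \<and> i = count I (bs ! 0, bs ! 1)"
  proof (induction rule: walk.induct)
    case (walk_edge a)
    then show ?case
      by (intro exI[of _ "[c, a]"]) (auto simp: inv_path_def)
  next
    case (walk_step b i a)
    then obtain bs where bs: "inv_path I c b bs" "\<forall>x\<in>set bs. b \<le> x" "i = count I (bs ! 0, bs ! 1)"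
      by blast
    have "0 < count I ((bs @ [a]) ! j, (bs @ [a]) ! Suc j)" if "Suc j < length (bs @ [a])" for j
    proof (cases "Suc j = length bs")
      case True
      have "bs \<noteq> []" "last bs = b"
        using bs(1) by (auto simp: inv_path_def)
      then have "bs ! j = b"
        using last_conv_nth[of bs] by (simp add: True[symmetric])
      then show ?thesis
        using True walk_step.hyps(3) by (simp add: nth_append)
    next
      case False
      then show ?thesis
        using bs(1) that by (simp add: inv_path_def nth_append)
    qed
    then have "inv_path I c a (bs @ [a])"
      using bs walk_step.hyps(2) by (auto simp: inv_path_def sorted_wrt_append hd_append)
    moreover have "i = count I ((bs @ [a]) ! 0, (bs @ [a]) ! 1)"
      using bs by (auto simp: inv_path_def nth_append)
    ultimately show ?case
      using bs(2) walk_step.hyps(2) by (intro exI[of _ "bs @ [a]"]) auto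
  qed
  then show "\<exists>bs. inv_path I c a bs \<and> i = count I (bs ! 0, bs ! 1)"
    by blast
next
  have "?W a (count I (bs ! 0, bs ! 1))" if "inv_path I c a bs" for bs
    using that
  proof (induction bs arbitrary: a rule: rev_induct)
    case (snoc x bs)
    then have [simp]: "x = a"
      by (simp add: inv_path_def)
    obtain b bs' where bs: "bs = bs' @ [b]"
      using snoc.prems by (cases bs rule: rev_cases) (auto simp: inv_path_def)
    have edge: "a < b" "0 < count I (b, a)"
      using snoc.prems
      by (auto simp: inv_path_def bs sorted_wrt_append nth_append dest: spec[of _ "length bs'"])
    \<comment> \<open>If \<open>bs'\<close> is empty, the path is the single edge from
      \<open>c\<close> to \<open>a\<close>; otherwise the shortened path has the same first
      edge.\<close>
    show ?case
    proof (cases bs')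
      case Nil
      then show ?thesis
        using snoc.prems edge bs walk_edge[of a b "\<lambda>y x. count I (y, x)"] by (simp add: inv_path_def)
    next
      case (Cons c' bs'')
      have "0 < count I (bs ! j, bs ! Suc j)" if "Suc j < length bs" for j
        using snoc.prems that by (auto simp: inv_path_def nth_append dest!: spec[of _ j])
      then have "inv_path I c b bs"
        using snoc.prems by (auto simp: inv_path_def bs Cons sorted_wrt_append)
      then have "?W b (count I (bs ! 0, bs ! 1))"
        by (rule snoc.IH)
      then have "?W a (count I (bs ! 0, bs ! 1))"
        using edge walk_step by simp
      then show ?thesis
        by (cases bs'') (simp_all add: bs Cons)
    qed
  qed (simp add: inv_path_def)
  then show "\<exists>bs. inv_path I c a bs \<and> i = count I (bs ! 0, bs ! 1) \<Longrightarrow> ?W a i"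
    by blast
qed

lemma count_tc_walk_max: "count (tc I) (c, a) = walk_max (\<lambda>y x. count I (y, x)) c a"
proof -
  have "{count I (bs ! 0, bs ! 1) | bs. inv_path I c a bs} = {i. walk (\<lambda>y x. count I (y, x)) c a i}"
    by (auto simp: walk_iff_inv_path)
  then show ?thesis
    unfolding count_tc walk_max_def by simp
qed

section \<open>Joins, meets and projections of cardinality functions\<close>

lemma tree_inversion_le: "tree_inversion S s f \<Longrightarrow> a \<in> S \<Longrightarrow> c \<in> S \<Longrightarrow> a < c \<Longrightarrow> f c a \<le> s c"
  unfolding tree_inversion_def by blast

lemma tree_inversion_trans:
  "tree_inversion S s f \<Longrightarrow> a \<in> S \<Longrightarrow> b \<in> S \<Longrightarrow> c \<in> S \<Longrightarrow> a < b \<Longrightarrow> b < c \<Longrightarrow> 0 < f b a \<Longrightarrow> f c b \<le> f c a"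
  unfolding tree_inversion_def by blast

lemma tree_inversion_planar:
  "tree_inversion S s f \<Longrightarrow> a \<in> S \<Longrightarrow> b \<in> S \<Longrightarrow> c \<in> S \<Longrightarrow> a < b \<Longrightarrow> b < c \<Longrightarrow> f b a < s b \<Longrightarrow> f c a \<le> f c b"
  unfolding tree_inversion_def by blast

text \<open>Values off the pairs \<open>a < c\<close> in \<open>S\<close> carry no meaning, so this
  is only a preorder; equality of functions is replaced by inequality in both directions.\<close>

definition le_fun :: "nat set \<Rightarrow> (nat \<Rightarrow> nat \<Rightarrow> nat) \<Rightarrow> (nat \<Rightarrow> nat \<Rightarrow> nat) \<Rightarrow> bool"
  where "le_fun S f g \<longleftrightarrow> (\<forall>a\<in>S. \<forall>c\<in>S. a < c \<longrightarrow> f c a \<le> g c a)"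

lemma le_fun_refl: "le_fun S f f"
  by (simp add: le_fun_def)

lemma le_fun_trans: "le_fun S f g \<Longrightarrow> le_fun S g h \<Longrightarrow> le_fun S f h"
  unfolding le_fun_def by (meson le_trans)

text \<open>The join is the closure of the pointwise maximum: planarity passes to the maximum and
  then to the closure, and an upper bound of \<open>f\<close> and \<open>g\<close>, being
  transitive, lies above all walks.\<close>

lemma ex_join_tree_inversion:
  assumes pos: "\<And>b. b \<in> S \<Longrightarrow> 0 < s b"
    and f: "tree_inversion S s f" and g: "tree_inversion S s g"
  shows "\<exists>h. tree_inversion S s h \<and> le_fun S f h \<and> le_fun S g h \<and>
    (\<forall>k. tree_inversion S s k \<longrightarrow> le_fun S f k \<longrightarrow> le_fun S g k \<longrightarrow> le_fun S h k)"
proof -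
  \<comment> \<open>The value 0 outside \<open>S\<close> confines the edges of \<open>m\<close> to
    \<open>S\<close>.\<close>
  define m where "m c a = (if a \<in> S \<and> c \<in> S then max (f c a) (g c a) else 0)" for c a
  have "s b \<le> m b a \<or> m c a \<le> m c b" if "a \<in> S" "b \<in> S" "c \<in> S" "a < b" "b < c" for a b c
  proof -
    have "s b \<le> f b a \<or> f c a \<le> f c b" "s b \<le> g b a \<or> g c a \<le> g c b"
      using tree_inversion_planar[OF f that] tree_inversion_planar[OF g that] by (meson not_le)+
    then show ?thesis
      using that by (auto simp: m_def max_def)
  qed
  then have "tree_inversion S s (walk_max m)"
    using tree_inversion_le[OF f] tree_inversion_le[OF g] pos
    by (intro tree_inversion_walk_max) (auto simp: m_def split: if_splits)
  moreover have "f c a \<le> walk_max m c a \<and> g c a \<le> walk_max m c a" if "a \<in> S" "c \<in> S" "a < c" for a c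
    using walk_max_ge[OF that(3), of m] that by (simp add: m_def)
  then have "le_fun S f (walk_max m)" "le_fun S g (walk_max m)"
    by (simp_all add: le_fun_def)
  moreover have "le_fun S (walk_max m) k"
    if "tree_inversion S s k" "le_fun S f k" "le_fun S g k" for k
    using that unfolding le_fun_def by (intro ballI impI walk_max_le) (auto simp: m_def split: if_splits)
  ultimately show ?thesis
    by blast
qed

text \<open>Complementation exchanges transitivity and planarity, so meets are dual to joins.\<close>

lemma tree_inversion_complement:
  "tree_inversion S s f \<Longrightarrow> tree_inversion S s (\<lambda>c a. s c - f c a)"
  unfolding tree_inversion_def by (auto intro!: diff_le_mono2)

lemma ex_meet_tree_inversion:
  assumes pos: "\<And>b. b \<in> S \<Longrightarrow> 0 < s b"
    and f: "tree_inversion S s f" and g: "tree_inversion S s g"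
  shows "\<exists>h. tree_inversion S s h \<and> le_fun S h f \<and> le_fun S h g \<and>
    (\<forall>k. tree_inversion S s k \<longrightarrow> le_fun S k f \<longrightarrow> le_fun S k g \<longrightarrow> le_fun S k h)"
proof -
  define C where "C f c a = s c - f c a" for f :: "nat \<Rightarrow> nat \<Rightarrow> nat" and c a
  have C: "tree_inversion S s f \<Longrightarrow> tree_inversion S s (C f)" for f
    unfolding C_def by (rule tree_inversion_complement)
  have anti: "le_fun S f g \<Longrightarrow> le_fun S (C g) (C f)" for f g
    by (auto simp: le_fun_def C_def intro: diff_le_mono2)
  \<comment> \<open>Truncated subtraction undoes itself because the values on pairs from
    \<open>S\<close> are at most \<open>s c\<close>.\<close>
  have CC: "le_fun S (C (C f)) f" "le_fun S f (C (C f))" if "tree_inversion S s f" for f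
    using tree_inversion_le[OF that] by (auto simp: le_fun_def C_def)
  obtain h where h: "tree_inversion S s h" "le_fun S (C f) h" "le_fun S (C g) h"
    "\<And>k. tree_inversion S s k \<Longrightarrow> le_fun S (C f) k \<Longrightarrow> le_fun S (C g) k \<Longrightarrow> le_fun S h k"
    using ex_join_tree_inversion[OF pos C[OF f] C[OF g]] by blast
  have "le_fun S (C h) f" "le_fun S (C h) g"
    using anti[OF h(2)] anti[OF h(3)] CC f g le_fun_trans by blast+
  moreover have "le_fun S k (C h)" if "tree_inversion S s k" "le_fun S k f" "le_fun S k g" for k
    by (rule le_fun_trans[OF CC(2)[OF that(1)] anti[OF h(4)[OF C[OF that(1)] anti[OF that(2)] anti[OF that(3)]]]])
  ultimately show ?thesis
    using C[OF h(1)] by blast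
qed

section \<open>The functions prescribed by \<open>pi_up\<close> and \<open>pi_down\<close>\<close>

definition up_fun :: "(nat \<Rightarrow> nat) \<Rightarrow> (nat \<Rightarrow> nat \<Rightarrow> nat) \<Rightarrow> nat \<Rightarrow> nat \<Rightarrow> nat"
  where "up_fun s f c a = (if \<exists>b. a < b \<and> b < c \<and> f b a = s b then s c else f c a)"

lemma up_fun_eq_s: "a < b \<Longrightarrow> b < c \<Longrightarrow> f b a = s b \<Longrightarrow> up_fun s f c a = s c"
  unfolding up_fun_def by metis

lemma up_fun_eq_self: "(\<And>b. a < b \<Longrightarrow> b < c \<Longrightarrow> f b a \<noteq> s b) \<Longrightarrow> up_fun s f c a = f c a"
  unfolding up_fun_def by metis

definition down_fun :: "(nat \<Rightarrow> nat \<Rightarrow> nat) \<Rightarrow> nat \<Rightarrow> nat \<Rightarrow> nat"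
  where "down_fun f c a = Min {f c b | b. a \<le> b \<and> b < c}"

lemma down_fun_image: "down_fun f c a = Min (f c ` {a..<c})"
  unfolding down_fun_def by (rule arg_cong[where f = Min]) auto

lemma down_fun_le: "a \<le> b \<Longrightarrow> b < c \<Longrightarrow> down_fun f c a \<le> f c b"
  unfolding down_fun_image by (rule Min_le) auto

lemma down_fun_ge_iff: "a < c \<Longrightarrow> k \<le> down_fun f c a \<longleftrightarrow> (\<forall>b. a \<le> b \<longrightarrow> b < c \<longrightarrow> k \<le> f c b)"
  unfolding down_fun_image by (subst Min_ge_iff) auto

lemma down_fun_mono: "a \<le> b \<Longrightarrow> b < c \<Longrightarrow> down_fun f c a \<le> down_fun f c b"
  by (simp add: down_fun_ge_iff down_fun_le)

text \<open>The right-hand side is the Tamari condition, so Tamari trees will be the fixed points of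
  \<open>pi_down\<close>.\<close>

lemma down_fun_eq_iff:
  "(\<forall>a c. 1 \<le> a \<and> a < c \<and> c \<le> n \<longrightarrow> down_fun f c a = f c a) \<longleftrightarrow>
    (\<forall>a b c. 1 \<le> a \<and> a < b \<and> b < c \<and> c \<le> n \<longrightarrow> f c a \<le> f c b)" (is "?L \<longleftrightarrow> ?R")
proof
  assume ?L
  then show ?R
    by (metis down_fun_le less_imp_le less_trans)
next
  assume ?R
  then have "f c a \<le> f c b" if "1 \<le> a" "a \<le> b" "b < c" "c \<le> n" for a b c
    using that by (cases "a = b") auto
  then show ?L
    by (intro allI impI antisym) (auto simp: down_fun_ge_iff intro: down_fun_le)
qed

locale positive_composition =
  fixes n :: nat and s :: "nat \<Rightarrow> nat"
  assumes comp: "composition n s"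
begin

abbreviation inversion_function :: "(nat \<Rightarrow> nat \<Rightarrow> nat) \<Rightarrow> bool"
  where "inversion_function \<equiv> tree_inversion {1..n} s"

abbreviation le_inv (infix \<open>\<preceq>\<close> 50)
  where "f \<preceq> g \<equiv> le_fun {1..n} f g"

lemma pos: "1 \<le> b \<Longrightarrow> b \<le> n \<Longrightarrow> 0 < s b"
  using comp by (simp add: composition_def)

lemma inv_le: "inversion_function f \<Longrightarrow> 1 \<le> a \<Longrightarrow> a < c \<Longrightarrow> c \<le> n \<Longrightarrow> f c a \<le> s c"
  by (rule tree_inversion_le) auto

lemma inv_trans:
  "inversion_function f \<Longrightarrow> 1 \<le> a \<Longrightarrow> a < b \<Longrightarrow> b < c \<Longrightarrow> c \<le> n \<Longrightarrow> 0 < f b a \<Longrightarrow> f c b \<le> f c a"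
  by (rule tree_inversion_trans) auto

lemma inv_planar:
  "inversion_function f \<Longrightarrow> 1 \<le> a \<Longrightarrow> a < b \<Longrightarrow> b < c \<Longrightarrow> c \<le> n \<Longrightarrow> f b a < s b \<Longrightarrow> f c a \<le> f c b"
  by (rule tree_inversion_planar) auto

lemma inv_full:
  "inversion_function f \<Longrightarrow> 1 \<le> a \<Longrightarrow> a < c \<Longrightarrow> c \<le> n \<Longrightarrow> s c \<le> f c a \<longleftrightarrow> f c a = s c"
  using inv_le by (metis le_antisym order_refl)

lemma inversion_functionI:
  assumes "\<And>a c. 1 \<le> a \<Longrightarrow> a < c \<Longrightarrow> c \<le> n \<Longrightarrow> f c a \<le> s c"
    and "\<And>a b c. 1 \<le> a \<Longrightarrow> a < b \<Longrightarrow> b < c \<Longrightarrow> c \<le> n \<Longrightarrow> 0 < f b a \<Longrightarrow> f c b \<le> f c a"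
    and "\<And>a b c. 1 \<le> a \<Longrightarrow> a < b \<Longrightarrow> b < c \<Longrightarrow> c \<le> n \<Longrightarrow> f b a < s b \<Longrightarrow> f c a \<le> f c b"
  shows "inversion_function f"
  unfolding tree_inversion_def using assms by simp

lemma le_invD: "f \<preceq> g \<Longrightarrow> 1 \<le> a \<Longrightarrow> a < c \<Longrightarrow> c \<le> n \<Longrightarrow> f c a \<le> g c a"
  by (simp add: le_fun_def)

text \<open>A full value of \<open>up_fun\<close> at \<open>b\<close> stems from a full entry of
  \<open>f\<close> at \<open>b\<close> or at a smaller label, and this entry also forces the full
  value at \<open>c\<close>.\<close>

lemma up_fun_full: "1 \<le> a \<Longrightarrow> a < b \<Longrightarrow> b < c \<Longrightarrow> up_fun s f b a = s b \<Longrightarrow> up_fun s f c a = s c"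
  unfolding up_fun_def by (metis less_trans)

text \<open>Unless the larger side is already \<open>s c\<close>, no full entry of \<open>f\<close>
  triggers it. Transitivity, respectively planarity, of \<open>f\<close> shows that none triggers
  the smaller side either, so both values come from \<open>f\<close>.\<close>

lemma inversion_function_up_fun:
  assumes f: "inversion_function f"
  shows "inversion_function (up_fun s f)"
proof (rule inversion_functionI)
  show "up_fun s f c a \<le> s c" if "1 \<le> a" "a < c" "c \<le> n" for a c
    using inv_le[OF f that] by (simp add: up_fun_def)
next
  fix a b c
  assume abc: "1 \<le> a" "a < b" "b < c" "c \<le> n"
  have le: "up_fun s f c b \<le> s c"
    using inv_le[OF f, of b c] abc by (simp add: up_fun_def)
  show "up_fun s f c b \<le> up_fun s f c a" if "0 < up_fun s f b a"
  proof (cases "up_fun s f c a = s c")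
    case False
    have no: "f e a \<noteq> s e" if "a < e" "e < c" for e
      using False up_fun_eq_s that by metis
    have "f b a < s b"
      using no[of b] inv_le[OF f, of a b] abc by auto
    have "0 < f b a"
      using that no abc up_fun_eq_self[of a b f s] by (metis less_trans)
    \<comment> \<open>A full entry at \<open>(e, b)\<close> would give one at \<open>(e, a)\<close>
      by transitivity.\<close>
    have "f e b \<noteq> s e" if "b < e" "e < c" for e
      using inv_trans[OF f, of a b e] inv_full[OF f, of a e] no[of e] that abc \<open>0 < f b a\<close> by auto
    then have "up_fun s f c b = f c b"
      by (rule up_fun_eq_self)
    moreover have "up_fun s f c a = f c a"
      using no by (rule up_fun_eq_self)
    ultimately show ?thesis
      using inv_trans[OF f abc \<open>0 < f b a\<close>] by simp
  qed (use le in simp)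
  show "up_fun s f c a \<le> up_fun s f c b" if u: "up_fun s f b a < s b"
  proof (cases "up_fun s f c b = s c")
    case True
    then show ?thesis
      using inv_le[OF f, of a c] abc by (auto simp: up_fun_def)
  next
    case False
    have le_fun_b: "f b a \<le> up_fun s f b a"
      using inv_le[OF f, of a b] abc by (simp add: up_fun_def)
    have b: "f b a < s b"
      using u le_fun_b by simp
    \<comment> \<open>For \<open>e < b\<close> a full entry would make \<open>up_fun s f b a\<close>
      full; for \<open>e > b\<close> planarity would transfer it to \<open>(e, b)\<close>.\<close>
    have "f e a \<noteq> s e" if e: "a < e" "e < c" for e
    proof (cases e b rule: linorder_cases)
      case less
      then show ?thesis
        using u e up_fun_eq_s[of a e b f s] by auto
    next
      case greater
      then have "f e b \<noteq> s e"
        using False e up_fun_eq_s by metis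
      then show ?thesis
        using inv_planar[OF f, of a b e] inv_full[OF f, of b e] b abc e greater by auto
    qed (use b in simp)
    then have "up_fun s f c a = f c a"
      by (intro up_fun_eq_self) blast
    moreover have "up_fun s f c b = f c b"
      using False unfolding up_fun_def by metis
    ultimately show ?thesis
      using inv_planar[OF f abc b] by simp
  qed
qed

text \<open>Planarity is monotonicity of the minimum in its second argument. For transitivity, a
  positive minimum makes all entries \<open>f b e\<close> with \<open>a \<le> e\<close> and
  \<open>e < b\<close> positive, so \<open>f c b\<close> is at most each of these
  \<open>f c e\<close>.\<close>

lemma inversion_function_down_fun:
  assumes f: "inversion_function f"
  shows "inversion_function (down_fun f)"
proof (rule inversion_functionI)
  show "down_fun f c a \<le> s c" if "1 \<le> a" "a < c" "c \<le> n" for a c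
    using inv_le[OF f that] down_fun_le[of a a c f] that by simp
next
  fix a b c
  assume abc: "1 \<le> a" "a < b" "b < c" "c \<le> n" and "0 < down_fun f b a"
  then have b: "0 < f b e" if "a \<le> e" "e < b" for e
    using that down_fun_le[of a e b f] by simp
  have "down_fun f c b \<le> f c e" if "a \<le> e" "e < c" for e
  proof (cases "e < b")
    case True
    then show ?thesis
      using inv_trans[OF f, of e b c] b[of e] down_fun_le[of b b c f] abc that by simp
  qed (use that down_fun_le in simp)
  then show "down_fun f c b \<le> down_fun f c a"
    using abc by (simp add: down_fun_ge_iff)
qed (simp add: down_fun_mono)

section \<open>Order properties of the projections\<close>

lemma le_up_fun: "inversion_function f \<Longrightarrow> f \<preceq> up_fun s f"
  by (auto simp: le_fun_def up_fun_def inv_le)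

lemma up_fun_le_up_fun:
  assumes g: "inversion_function g" and le: "f \<preceq> g"
    and f: "inversion_function f"
  shows "up_fun s f \<preceq> up_fun s g"
proof -
  have "up_fun s f c a \<le> up_fun s g c a" if ac: "1 \<le> a" "a < c" "c \<le> n" for a c
  proof (cases "\<exists>b. a < b \<and> b < c \<and> f b a = s b")
    case True
    then obtain b where b: "a < b" "b < c" "f b a = s b"
      by blast
    then have "g b a = s b"
      using le_invD[OF le, of a b] inv_full[OF g, of a b] ac by auto
    then show ?thesis
      using b inv_le[OF f ac] up_fun_eq_s[of a b c g s] by (simp add: up_fun_def)
  next
    case False
    then have "up_fun s f c a = f c a"
      by (intro up_fun_eq_self) blast
    also have "\<dots> \<le> g c a"
      using le_invD[OF le ac] .
    also have "\<dots> \<le> up_fun s g c a"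
      using le_invD[OF le_up_fun[OF g] ac] .
    finally show ?thesis .
  qed
  then show ?thesis
    by (auto simp: le_fun_def)
qed

lemma up_fun_up_fun: "1 \<le> a \<Longrightarrow> up_fun s (up_fun s f) c a = up_fun s f c a"
  using up_fun_full[of a _ c f] by (subst up_fun_def) metis

lemma down_fun_le_self: "down_fun f \<preceq> f"
  by (auto simp: le_fun_def down_fun_le)

lemma down_fun_le_down_fun: "f \<preceq> g \<Longrightarrow> down_fun f \<preceq> down_fun g"
  unfolding le_fun_def
proof (intro ballI impI)
  fix a c
  assume le: "\<forall>a\<in>{1..n}. \<forall>c\<in>{1..n}. a < c \<longrightarrow> f c a \<le> g c a" and ac: "a \<in> {1..n}" "c \<in> {1..n}" "a < c"
  have "down_fun f c a \<le> g c b" if "a \<le> b" "b < c" for b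
    using down_fun_le[OF that, of f] le ac that by fastforce
  then show "down_fun f c a \<le> down_fun g c a"
    using ac by (simp add: down_fun_ge_iff)
qed

lemma down_fun_down_fun:
  assumes "a < c"
  shows "down_fun (down_fun f) c a = down_fun f c a"
proof (rule antisym)
  show "down_fun (down_fun f) c a \<le> down_fun f c a"
    using assms by (intro down_fun_le) auto
  show "down_fun f c a \<le> down_fun (down_fun f) c a"
    using assms by (subst down_fun_ge_iff) (auto intro: down_fun_mono)
qed

text \<open>As long as a full entry \<open>f e a\<close> raises the value at \<open>a\<close>,
  replace \<open>a\<close> by \<open>e\<close>: positivity of \<open>s e\<close> and transitivity
  give \<open>f c e \<le> f c a\<close>, and \<open>e\<close> is closer to \<open>c\<close>.\<close>

lemma ex_up_fun_le:
  assumes f: "inversion_function f"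
  shows "1 \<le> a \<Longrightarrow> a < c \<Longrightarrow> c \<le> n \<Longrightarrow> \<exists>b\<ge>a. b < c \<and> up_fun s f c b \<le> f c a"
proof (induction "c - a" arbitrary: a rule: less_induct)
  case less
  show ?case
  proof (cases "\<exists>e. a < e \<and> e < c \<and> f e a = s e")
    case True
    then obtain e where e: "a < e" "e < c" "f e a = s e"
      by blast
    then have "f c e \<le> f c a"
      using inv_trans[OF f, of a e c] pos[of e] less.prems by simp
    moreover have "\<exists>b\<ge>e. b < c \<and> up_fun s f c b \<le> f c e"
      using less.hyps[of e] e less.prems by simp
    ultimately show ?thesis
      using e by (meson le_trans less_imp_le)
  next
    case False
    then have "up_fun s f c a = f c a"
      by (intro up_fun_eq_self) blast
    then show ?thesis
      using less.prems by auto
  qed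
qed

lemma down_fun_up_fun_le:
  assumes f: "inversion_function f"
  shows "down_fun (up_fun s f) \<preceq> f"
proof -
  have "down_fun (up_fun s f) c a \<le> f c a" if ac: "1 \<le> a" "a < c" "c \<le> n" for a c
  proof -
    obtain b where "a \<le> b" "b < c" "up_fun s f c b \<le> f c a"
      using ex_up_fun_le[OF f ac] by blast
    then show ?thesis
      using down_fun_le[of a b c "up_fun s f"] by simp
  qed
  then show ?thesis
    by (simp add: le_fun_def)
qed

text \<open>If the minimum is smaller than \<open>f c a\<close>, planarity provides a full entry
  \<open>f b a\<close>. At the least such label \<open>e\<close> the minimum is itself full, which
  triggers \<open>up_fun\<close> at \<open>c\<close>.\<close>

lemma le_up_fun_down_fun:
  assumes f: "inversion_function f"
  shows "f \<preceq> up_fun s (down_fun f)"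
proof -
  have "f c a \<le> up_fun s (down_fun f) c a" if ac: "1 \<le> a" "a < c" "c \<le> n" for a c
  proof (cases "f c a \<le> down_fun f c a")
    case True
    then show ?thesis
      using le_up_fun[OF inversion_function_down_fun[OF f]] le_invD ac by (metis le_trans)
  next
    case False
    then obtain b where b: "a \<le> b" "b < c" "f c b < f c a"
      using ac by (auto simp: down_fun_ge_iff not_le)
    then have ab: "a < b"
      by (metis le_neq_implies_less less_irrefl)
    have "f b a = s b"
      using inv_planar[OF f, of a b c] inv_le[OF f, of a b] b ab ac by (meson le_neq_implies_less less_imp_le less_le_trans not_le)
    define e where "e = (LEAST e. a < e \<and> f e a = s e)"
    have e: "a < e" "f e a = s e"
      using LeastI[of "\<lambda>e. a < e \<and> f e a = s e" b] ab \<open>f b a = s b\<close> by (auto simp: e_def)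
    have "e \<le> b"
      unfolding e_def using ab \<open>f b a = s b\<close> by (intro Least_le) simp
    have lt: "f x a < s x" if "a < x" "x < e" for x
      using not_less_Least[of x "\<lambda>e. a < e \<and> f e a = s e"] inv_le[OF f, of a x] that \<open>e \<le> b\<close> b ac
      by (auto simp: e_def[symmetric] le_neq_implies_less)
    \<comment> \<open>The entries \<open>f x a\<close> before \<open>e\<close> are not full, so
      planarity bounds \<open>f e x\<close> below by \<open>f e a = s e\<close>.\<close>
    have "s e \<le> f e x" if "a \<le> x" "x < e" for x
      using inv_planar[OF f, of a x e] lt[of x] that e \<open>e \<le> b\<close> b ac by (cases "x = a") auto
    then have "s e \<le> down_fun f e a"
      using e by (simp add: down_fun_ge_iff)
    then have "down_fun f e a = s e"
      using inv_full[OF inversion_function_down_fun[OF f], of a e] e \<open>e \<le> b\<close> b ac by simp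
    then have "up_fun s (down_fun f) c a = s c"
      using e \<open>e \<le> b\<close> b by (intro up_fun_eq_s[of a e]) auto
    then show ?thesis
      using inv_le[OF f ac] by simp
  qed
  then show ?thesis
    by (simp add: le_fun_def)
qed

end

section \<open>Lattices with a pair of projections\<close>

text \<open>Least upper and greatest lower bounds depend on the order alone, so an order isomorphism
  carries them over; in particular \<open>M\<close> is shown to be a lattice here.\<close>

lemma lattice_isomorphicI:
  fixes L :: "('a, 'c) gorder_scheme" and M :: "('b, 'd) gorder_scheme"
  assumes "lattice L" "partial_order M" and bij: "bij_betw f (carrier L) (carrier M)"
    and mono: "\<And>x y. x \<in> carrier L \<Longrightarrow> y \<in> carrier L \<Longrightarrow> f x \<sqsubseteq>\<^bsub>M\<^esub> f y \<longleftrightarrow> x \<sqsubseteq>\<^bsub>L\<^esub> y"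
  shows "lattice_isomorphic L M"
proof -
  interpret L: lattice L by fact
  interpret M: partial_order M by fact
  have f: "f x \<in> carrier M" if "x \<in> carrier L" for x
    using bij that by (auto simp: bij_betw_def)
  have img: "carrier M = f ` carrier L"
    using bij by (simp add: bij_betw_def)
  have lub: "least M (f z) (Upper M {f x, f y})"
    if "x \<in> carrier L" "y \<in> carrier L" "least L z (Upper L {x, y})" for x y z
    using that f unfolding least_def Upper_def img by (auto simp: mono)
  have glb: "greatest M (f z) (Lower M {f x, f y})"
    if "x \<in> carrier L" "y \<in> carrier L" "greatest L z (Lower L {x, y})" for x y z
    using that f unfolding greatest_def Lower_def img by (auto simp: mono)
  interpret M: lattice M
  proof
    fix p q
    assume "p \<in> carrier M" "q \<in> carrier M"
    then obtain x y where "x \<in> carrier L" "y \<in> carrier L" "p = f x" "q = f y"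
      by (auto simp: img)
    then show "\<exists>s. least M s (Upper M {p, q})" "\<exists>s. greatest M s (Lower M {p, q})"
      using lub glb L.sup_of_two_exists L.inf_of_two_exists by blast+
  qed
  have "f (x \<squnion>\<^bsub>L\<^esub> y) = f x \<squnion>\<^bsub>M\<^esub> f y" if xy: "x \<in> carrier L" "y \<in> carrier L" for x y
  proof (rule M.least_unique)
    show "least M (f (x \<squnion>\<^bsub>L\<^esub> y)) (Upper M {f x, f y})"
      using L.joinI[where P = "\<lambda>l. least L l (Upper L {x, y})"] xy by (intro lub) auto
    show "least M (f x \<squnion>\<^bsub>M\<^esub> f y) (Upper M {f x, f y})"
      using M.joinI[where P = "\<lambda>l. least M l (Upper M {f x, f y})"] xy f by auto
  qed
  moreover have "f (x \<sqinter>\<^bsub>L\<^esub> y) = f x \<sqinter>\<^bsub>M\<^esub> f y" if xy: "x \<in> carrier L" "y \<in> carrier L" for x y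
  proof (rule M.greatest_unique)
    show "greatest M (f (x \<sqinter>\<^bsub>L\<^esub> y)) (Lower M {f x, f y})"
      using L.meetI[where P = "\<lambda>l. greatest L l (Lower L {x, y})"] xy by (intro glb) auto
    show "greatest M (f x \<sqinter>\<^bsub>M\<^esub> f y) (Lower M {f x, f y})"
      using M.meetI[where P = "\<lambda>l. greatest M l (Lower M {f x, f y})"] xy f by auto
  qed
  ultimately show ?thesis
    unfolding lattice_isomorphic_def join_pres_def meet_pres_def
    using bij L.lattice_axioms M.lattice_axioms by blast
qed

text \<open>The abstract situation of \<open>pi_down\<close> and \<open>pi_up\<close>. The
  absorption laws \<open>d_u\<close> and \<open>u_d\<close> imply that both maps are idempotent and
  have the same fibres.\<close>

locale projection_pair = lattice L for L (structure) +
  fixes d u :: "'a \<Rightarrow> 'a"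
  assumes d_closed [simp]: "x \<in> carrier L \<Longrightarrow> d x \<in> carrier L"
    and u_closed [simp]: "x \<in> carrier L \<Longrightarrow> u x \<in> carrier L"
    and d_mono: "x \<in> carrier L \<Longrightarrow> y \<in> carrier L \<Longrightarrow> x \<sqsubseteq> y \<Longrightarrow> d x \<sqsubseteq> d y"
    and u_mono: "x \<in> carrier L \<Longrightarrow> y \<in> carrier L \<Longrightarrow> x \<sqsubseteq> y \<Longrightarrow> u x \<sqsubseteq> u y"
    and d_le: "x \<in> carrier L \<Longrightarrow> d x \<sqsubseteq> x"
    and le_u: "x \<in> carrier L \<Longrightarrow> x \<sqsubseteq> u x"
    and d_u [simp]: "x \<in> carrier L \<Longrightarrow> d (u x) = d x"
    and u_d [simp]: "x \<in> carrier L \<Longrightarrow> u (d x) = u x"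
begin

definition fibres :: "('a \<times> 'a) set"
  where "fibres = {(x, y). x \<in> carrier L \<and> y \<in> carrier L \<and> u x = u y}"

lemma u_eq_iff_d_eq: "x \<in> carrier L \<Longrightarrow> y \<in> carrier L \<Longrightarrow> u x = u y \<longleftrightarrow> d x = d y"
  by (metis d_u u_d)

text \<open>By absorption, \<open>d (d x) = d (u (d x)) = d (u x) = d x\<close>.\<close>

lemma d_d [simp]: "x \<in> carrier L \<Longrightarrow> d (d x) = d x"
  by (metis d_u u_d d_closed)

lemma u_u [simp]: "x \<in> carrier L \<Longrightarrow> u (u x) = u x"
  by (metis d_u u_d u_closed)

lemma equiv_fibres: "equiv (carrier L) fibres"
  by (auto simp: fibres_def intro!: equivI refl_onI symI transI)

text \<open>For \<open>y\<close> in the interval,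
  \<open>u x = u (d x) \<sqsubseteq> u y \<sqsubseteq> u (u x) = u x\<close>; for \<open>y\<close>
  in the fibre, \<open>d y = d x\<close> and \<open>u y = u x\<close> enclose
  \<open>y\<close>.\<close>

lemma fibre_eq_interval:
  assumes x: "x \<in> carrier L"
  shows "fibres `` {x} = \<lbrace>d x..u x\<rbrace>"
proof -
  have "u y = u x" if y: "y \<in> carrier L" "d x \<sqsubseteq> y" "y \<sqsubseteq> u x" for y
    using u_mono[OF d_closed[OF x] y(1,2)] u_mono[OF y(1) u_closed[OF x] y(3)] x y by (simp add: le_antisym)
  moreover have "d x \<sqsubseteq> y \<and> y \<sqsubseteq> u x" if "y \<in> carrier L" "u x = u y" for y
    using that x d_le[of y] le_u[of y] by (metis u_eq_iff_d_eq)
  ultimately have "y \<in> carrier L \<and> u x = u y \<longleftrightarrow> y \<in> carrier L \<and> d x \<sqsubseteq> y \<and> y \<sqsubseteq> u x" for y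
    by metis
  then show ?thesis
    using x by (simp add: fibres_def at_least_at_most_def Image_def)
qed

lemma fibre_bounds:
  assumes "x \<in> carrier L"
  shows "least L (d x) (fibres `` {x})" "greatest L (u x) (fibres `` {x})"
  using assms by (auto simp: fibre_eq_interval least_def greatest_def at_least_at_most_def
      intro: le_trans[OF d_le le_u])

lemma class_bottom_fibres: "x \<in> carrier L \<Longrightarrow> class_bottom L fibres x = d x"
  unfolding class_bottom_def using fibre_bounds(1) least_unique by blast

lemma class_top_fibres: "x \<in> carrier L \<Longrightarrow> class_top L fibres x = u x"
  unfolding class_top_def using fibre_bounds(2) greatest_unique by blast

lemma lattice_congruence_fibres:
  assumes "finite (carrier L)"
  shows "lattice_congruence L fibres"
  unfolding lattice_congruence_def
proof (intro conjI ballI)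
  show "\<exists>l\<in>carrier L. \<exists>u\<in>carrier L. X = \<lbrace>l..u\<rbrace>" if "X \<in> carrier L // fibres" for X
    using that by (elim quotientE) (metis d_closed u_closed fibre_eq_interval)
  show "isotone L L (class_bottom L fibres)" "isotone L L (class_top L fibres)"
    by (auto intro!: isotoneI weak_partial_order_axioms simp: class_bottom_fibres class_top_fibres d_mono u_mono)
qed (use assms equiv_fibres lattice_axioms in auto)

text \<open>\<open>d\<close> is an interior operator, so joins of fixed points are fixed, while a
  meet is first pushed down by \<open>d\<close>.\<close>

lemma lattice_fixed_points: "lattice (L\<lparr>carrier := {x \<in> carrier L. d x = x}\<rparr>)" (is "lattice ?F")
proof -
  interpret F: weak_partial_order ?F
    by (rule weak_partial_order_subset) (auto intro: weak_partial_order_axioms)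
  show ?thesis
  proof
    show "(.=\<^bsub>?F\<^esub>) = (=)"
      by (simp add: eq_is_equal)
    fix x y
    assume "x \<in> carrier ?F" "y \<in> carrier ?F"
    then have x: "x \<in> carrier L" "d x = x" and y: "y \<in> carrier L" "d y = y"
      by auto
    have j: "x \<squnion> y \<in> carrier L" and m: "x \<sqinter> y \<in> carrier L"
      using x y by auto
    have "x \<sqsubseteq> d (x \<squnion> y)" "y \<sqsubseteq> d (x \<squnion> y)"
      using d_mono[OF x(1) j join_left] d_mono[OF y(1) j join_right] x y by auto
    then have "d (x \<squnion> y) = x \<squnion> y"
      using j x y d_le by (intro le_antisym join_le) auto
    then have "least ?F (x \<squnion> y) (Upper ?F {x, y})"
      using x y j by (auto simp: least_def Upper_def join_left join_right join_le)
    then show "\<exists>s. least ?F s (Upper ?F {x, y})"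
      by blast
    have "greatest ?F (d (x \<sqinter> y)) (Lower ?F {x, y})"
    proof (rule greatest_LowerI)
      show "d (x \<sqinter> y) \<sqsubseteq>\<^bsub>?F\<^esub> z" if "z \<in> {x, y}" for z
        using that le_trans[OF d_le[OF m] meet_left] le_trans[OF d_le[OF m] meet_right] x y m by auto
      show "z \<sqsubseteq>\<^bsub>?F\<^esub> d (x \<sqinter> y)" if "z \<in> Lower ?F {x, y}" for z
      proof -
        have "z \<in> carrier L" "d z = z" "z \<sqsubseteq> x" "z \<sqsubseteq> y"
          using that x y by (auto simp: Lower_def)
        then show ?thesis
          using d_mono[of z "x \<sqinter> y"] meet_le[of z x y] x y m by simp
      qed
    qed (use x y m in auto)
    then show "\<exists>s. greatest ?F s (Lower ?F {x, y})"
      by blast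
  qed
qed

text \<open>Bottom elements represent the classes: \<open>d\<close> is monotone and constant on each
  fibre, and \<open>d x\<close>, \<open>d y\<close> are themselves members.\<close>

lemma quotient_le_iff:
  assumes x: "x \<in> carrier L" and y: "y \<in> carrier L"
  shows "fibres `` {x} \<sqsubseteq>\<^bsub>quotient_order L fibres\<^esub> fibres `` {y} \<longleftrightarrow> d x \<sqsubseteq> d y"
proof
  assume "fibres `` {x} \<sqsubseteq>\<^bsub>quotient_order L fibres\<^esub> fibres `` {y}"
  then obtain x' y' where "(x, x') \<in> fibres" "(y, y') \<in> fibres" "x' \<sqsubseteq> y'"
    by (auto simp: quotient_order_def)
  then show "d x \<sqsubseteq> d y"
    using u_eq_iff_d_eq d_mono by (auto simp: fibres_def)
next
  assume "d x \<sqsubseteq> d y"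
  moreover have "d x \<in> fibres `` {x}" "d y \<in> fibres `` {y}"
    using x y by (auto simp: fibres_def)
  ultimately show "fibres `` {x} \<sqsubseteq>\<^bsub>quotient_order L fibres\<^esub> fibres `` {y}"
    by (auto simp: quotient_order_def)
qed

lemma fibre_eq_iff: "x \<in> carrier L \<Longrightarrow> y \<in> carrier L \<Longrightarrow> fibres `` {x} = fibres `` {y} \<longleftrightarrow> d x = d y"
  by (subst eq_equiv_class_iff[OF equiv_fibres]) (simp_all add: fibres_def u_eq_iff_d_eq)

lemma partial_order_quotient: "partial_order (quotient_order L fibres)" (is "partial_order ?Q")
proof -
  have rep: "\<exists>x\<in>carrier L. X = fibres `` {x}" if "X \<in> carrier ?Q" for X
    using that by (auto simp: quotient_order_def elim: quotientE)
  have eq: "(.=\<^bsub>?Q\<^esub>) = (=)"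
    by (simp add: quotient_order_def)
  show ?thesis
  proof
    fix X Y Z
    assume X: "X \<in> carrier ?Q"
    then show "X \<sqsubseteq>\<^bsub>?Q\<^esub> X"
      using rep quotient_le_iff by fastforce
    assume Y: "Y \<in> carrier ?Q"
    show "X \<sqsubseteq>\<^bsub>?Q\<^esub> Y \<Longrightarrow> Y \<sqsubseteq>\<^bsub>?Q\<^esub> X \<Longrightarrow> X .=\<^bsub>?Q\<^esub> Y"
      using rep[OF X] rep[OF Y] le_antisym[OF _ _ d_closed d_closed] unfolding eq
      by (metis fibre_eq_iff quotient_le_iff)
    assume Z: "Z \<in> carrier ?Q"
    show "X \<sqsubseteq>\<^bsub>?Q\<^esub> Y \<Longrightarrow> Y \<sqsubseteq>\<^bsub>?Q\<^esub> Z \<Longrightarrow> X \<sqsubseteq>\<^bsub>?Q\<^esub> Z"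
      using rep[OF X] rep[OF Y] rep[OF Z] le_trans[OF _ _ d_closed d_closed d_closed]
      by (metis quotient_le_iff)
  qed (auto simp: eq)
qed

text \<open>Every class contains exactly one fixed point of \<open>d\<close>, its least element. The
  map starts from the fixed points, so that their lattice structure is transported to the
  quotient.\<close>

lemma fixed_points_isomorphic_quotient:
  "lattice_isomorphic (L\<lparr>carrier := {x \<in> carrier L. d x = x}\<rparr>) (quotient_order L fibres)"
proof (rule lattice_isomorphicI[OF lattice_fixed_points partial_order_quotient])
  let ?f = "\<lambda>x. fibres `` {x}"
  show "bij_betw ?f (carrier (L\<lparr>carrier := {x \<in> carrier L. d x = x}\<rparr>)) (carrier (quotient_order L fibres))"
  proof (rule bij_betwI')
    show "\<exists>x\<in>carrier (L\<lparr>carrier := {x \<in> carrier L. d x = x}\<rparr>). X = ?f x"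
      if X: "X \<in> carrier (quotient_order L fibres)" for X
    proof -
      obtain x where "x \<in> carrier L" "X = ?f x"
        using X by (auto simp: quotient_order_def elim: quotientE)
      then show ?thesis
        by (intro bexI[of _ "d x"]) (auto simp: fibre_eq_iff)
    qed
  qed (auto simp: fibre_eq_iff quotient_order_def intro: quotientI)
qed (auto simp: quotient_le_iff)

end

section \<open>Ascents\<close>

context positive_composition
begin

text \<open>By \<open>descendant_iff_cardinality\<close>, \<open>desc f a c\<close> says that \<open>a\<close> is a descendant of \<open>c\<close>.\<close>

definition desc :: "(nat \<Rightarrow> nat \<Rightarrow> nat) \<Rightarrow> nat \<Rightarrow> nat \<Rightarrow> bool"
  where "desc f a c \<longleftrightarrow> (\<forall>e. c < e \<longrightarrow> e \<le> n \<longrightarrow> f e a = f e c)"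

text \<open>The conditions of \<open>tree_ascent\<close> read off the function;
  \<open>tree_ascent_iff_ascent\<close> states the equivalence.\<close>

definition ascent :: "(nat \<Rightarrow> nat \<Rightarrow> nat) \<Rightarrow> nat \<Rightarrow> nat \<Rightarrow> bool"
  where "ascent f a c \<longleftrightarrow> 1 \<le> a \<and> a < c \<and> c \<le> n \<and> desc f a c \<and> f c a < s c \<and>
    (\<forall>b. a < b \<longrightarrow> b < c \<longrightarrow> desc f a b \<longrightarrow> f b a = s b) \<and>
    (\<forall>x. 1 \<le> x \<longrightarrow> x < a \<longrightarrow> desc f x a \<longrightarrow> f a x \<noteq> s a)"

text \<open>The strict inequality leaves room to raise \<open>f c a\<close> by one without losing
  planarity. If equality held, some \<open>e > b\<close> would separate \<open>a\<close> from
  \<open>b\<close>, because an ancestor \<open>b\<close> of \<open>a\<close> would have a full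
  entry; each position of \<open>e\<close> relative to \<open>c\<close> is then
  contradictory.\<close>

lemma ascent_less:
  assumes f: "inversion_function f" and ac: "ascent f a c"
  shows "a < b \<Longrightarrow> b < c \<Longrightarrow> f b a < s b \<Longrightarrow> f c a < f c b"
proof (induction "c - b" arbitrary: b rule: less_induct)
  case less
  have a: "1 \<le> a" "c \<le> n" and desc: "\<And>e. c < e \<Longrightarrow> e \<le> n \<Longrightarrow> f e a = f e c" and full: "f c a < s c"
    using ac by (auto simp: ascent_def desc_def)
  show ?case
  proof (rule ccontr)
    assume "\<not> f c a < f c b"
    then have eq: "f c b = f c a"
      using inv_planar[OF f a(1) less.prems(1,2) a(2) less.prems(3)] by simp
    have "\<not> desc f a b"
      using ac less.prems by (auto simp: ascent_def)
    then obtain e where e: "b < e" "e \<le> n" "f e a \<noteq> f e b"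
      by (auto simp: desc_def)
    then have lt: "f e a < f e b"
      using inv_planar[OF f a(1) less.prems(1) e(1,2) less.prems(3)] by simp
    show False
    proof (cases e c rule: linorder_cases)
      \<comment> \<open>The induction hypothesis at \<open>e\<close>, which is closer to
        \<open>c\<close>, contradicts transitivity for \<open>b < e < c\<close>.\<close>
      case less': less
      have "f e a < s e"
        using lt inv_le[OF f, of b e] a less.prems e by simp
      then have "f c a < f c e"
        using less.hyps[of e] less' e less.prems by simp
      moreover have "f c e \<le> f c b"
        using inv_trans[OF f, of b e c] lt a less.prems e less' by simp
      ultimately show False
        using eq by simp
    next
      case equal
      then show False
        using e eq by simp
    next
      \<comment> \<open>Since \<open>a\<close> descends from \<open>c\<close>,
        \<open>f e a = f e c\<close>, and planarity for \<open>b < c < e\<close> would make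
        \<open>f c b\<close> full.\<close>
      case greater
      then have "f e c < f e b"
        using desc e lt by simp
      then have "s c \<le> f c b"
        using inv_planar[OF f, of b c e] a less.prems e greater by (meson le_trans less_imp_le not_le)
      then show False
        using eq full by simp
    qed
  qed
qed

text \<open>Extremal choices produce the ascent: the greatest candidate \<open>a\<close> and then
  the least suitable \<open>c\<close> secure the condition on nodes between them; passing from
  \<open>a\<close> to the least suitable \<open>x\<close> empties the last child while keeping the
  other conditions.\<close>

lemma ex_congruence_ascent:
  assumes f: "inversion_function f" and not_max: "\<not> up_fun s f \<preceq> f"
  shows "\<exists>a b c. ascent f a c \<and> a < b \<and> b < c \<and> f b a = s b"
proof -
  define cand where "cand a \<longleftrightarrow> (\<exists>b c. 1 \<le> a \<and> a < b \<and> b < c \<and> c \<le> n \<and> f b a = s b \<and> f c a < s c)" for a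
  obtain a0 c0 where a0: "1 \<le> a0" "a0 < c0" "c0 \<le> n" "f c0 a0 < up_fun s f c0 a0"
    using not_max by (auto simp: le_fun_def not_le)
  then obtain b0 where b0: "a0 < b0" "b0 < c0" "f b0 a0 = s b0"
    using up_fun_eq_self[of a0 c0 f s] by force
  then have "f c0 a0 < s c0"
    using a0(4) up_fun_eq_s[of a0 b0 c0 f s] by simp
  then have "cand a0"
    unfolding cand_def using a0 b0 by blast
  have fin: "finite {a. cand a}"
    by (rule finite_subset[of _ "{..n}"]) (auto simp: cand_def)
  define a where "a = Max {a. cand a}"
  have "cand a"
    using Max_in[OF fin] \<open>cand a0\<close> unfolding a_def by blast
  have a_max: "x \<le> a" if "cand x" for x
    using Max_ge[OF fin] that by (simp add: a_def)
  obtain b c1 where b: "1 \<le> a" "a < b" "f b a = s b" and c1: "b < c1" "c1 \<le> n" "f c1 a < s c1"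
    using \<open>cand a\<close> by (auto simp: cand_def)
  define P where "P c \<longleftrightarrow> b < c \<and> c \<le> n \<and> f c a < s c" for c
  have finP: "finite {c. P c}"
    by (rule finite_subset[of _ "{..n}"]) (auto simp: P_def)
  \<comment> \<open>The greatest label with a non-full entry is an ancestor of \<open>a\<close>: all
    later entries of \<open>a\<close> are full, and planarity makes those of \<open>m\<close> full
    too.\<close>
  define m where "m = Max {c. P c}"
  have "P m"
    using Max_in[OF finP] P_def[of c1] c1 unfolding m_def by blast
  have m_max: "x \<le> m" if "P x" for x
    using Max_ge[OF finP] that by (simp add: m_def)
  have "desc f a m"
    unfolding desc_def
  proof (intro allI impI)
    fix e
    assume e: "m < e" "e \<le> n"
    then have "s e \<le> f e a"
      using m_max[of e] \<open>P m\<close> by (force simp: P_def)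
    moreover have "f e a \<le> f e m" "f e m \<le> s e"
      using inv_planar[OF f, of a m e] inv_le[OF f, of m e] \<open>P m\<close> b e by (auto simp: P_def)
    ultimately show "f e a = f e m"
      by simp
  qed
  define c where "c = (LEAST c. P c \<and> desc f a c)"
  have c: "b < c" "c \<le> n" "f c a < s c" "desc f a c"
    using LeastI[of "\<lambda>c. P c \<and> desc f a c" m] \<open>P m\<close> \<open>desc f a m\<close> by (auto simp: c_def P_def)
  have a_full: "f e a = s e" if e: "a < e" "e < c" "desc f a e" for e
  proof (rule ccontr)
    assume "f e a \<noteq> s e"
    then have lt: "f e a < s e"
      using inv_le[OF f b(1) e(1)] e c by simp
    show False
    proof (cases e b rule: linorder_cases)
      case less
      \<comment> \<open>As \<open>a\<close> descends from \<open>e\<close>, both have the same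
        entries at \<open>b\<close> and \<open>c\<close>, so \<open>e\<close> would be a greater
        candidate.\<close>
      then have "cand e"
        unfolding cand_def using e b c by (intro exI[of _ b] exI[of _ c]) (auto simp: desc_def)
      then show False
        using a_max[of e] e by simp
    next
      case greater
      then have "P e"
        using lt e c by (simp add: P_def)
      then show False
        using not_less_Least[of e "\<lambda>c. P c \<and> desc f a c"] e by (simp add: c_def[symmetric])
    qed (use lt b in simp)
  qed
  \<comment> \<open>All conditions of a congruence ascent except the one on the last child of
    \<open>x\<close>.\<close>
  define X where "X x \<longleftrightarrow> 1 \<le> x \<and> x < c \<and> desc f x c \<and> f c x < s c \<and>
    (\<forall>e. x < e \<longrightarrow> e < c \<longrightarrow> desc f x e \<longrightarrow> f e x = s e) \<and> (\<exists>b. x < b \<and> b < c \<and> f b x = s b)" for x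
  have "X a"
    unfolding X_def using b c a_full by auto
  define x where "x = (LEAST x. X x)"
  have x: "1 \<le> x" "x < c" "desc f x c" "f c x < s c" "\<And>e. x < e \<Longrightarrow> e < c \<Longrightarrow> desc f x e \<Longrightarrow> f e x = s e"
    using LeastI[of X, OF \<open>X a\<close>] by (auto simp: x_def X_def)
  obtain b' where b': "x < b'" "b' < c" "f b' x = s b'"
    using LeastI[of X, OF \<open>X a\<close>] by (auto simp: x_def X_def)
  have "f x y \<noteq> s x" if y0: "1 \<le> y" "y < x" "desc f y x" for y
  proof
    assume y1: "f x y = s x"
    \<comment> \<open>\<open>Y\<close> holds the internal nodes of the last child of
      \<open>x\<close>. Its greatest element \<open>z\<close>, the root of that child, again
      satisfies \<open>X\<close>, against the choice of \<open>x\<close>.\<close>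
    define Y where "Y = {y. 1 \<le> y \<and> y < x \<and> desc f y x \<and> f x y = s x}"
    have finY: "finite Y"
      by (rule finite_subset[of _ "{..x}"]) (auto simp: Y_def)
    define z where "z = Max Y"
    have "z \<in> Y"
      using Max_in[OF finY] y0 y1 unfolding z_def Y_def by blast
    then have z: "1 \<le> z" "z < x" "desc f z x" "f x z = s x"
      by (auto simp: Y_def)
    have z_max: "y \<le> z" if "y \<in> Y" for y
      using Max_ge[OF finY that] by (simp add: z_def)
    have above: "f e z = f e x" if "x < e" "e \<le> n" for e
      using z(3) that by (simp add: desc_def)
    have "f e z = s e" if e: "z < e" "e < c" "desc f z e" for e
    proof (cases e x rule: linorder_cases)
      case less
      \<comment> \<open>An ancestor \<open>e\<close> of \<open>z\<close> below \<open>x\<close>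
        would lie in \<open>Y\<close> and exceed \<open>z\<close>.\<close>
      have "desc f e x" "f x e = s x"
        using e(3) less above x(2) c(2) z(4) by (auto simp: desc_def)
      then have "e \<in> Y"
        using less e(1) z(1) by (simp add: Y_def)
      then show ?thesis
        using z_max[of e] e(1) by simp
    next
      case greater
      have "desc f x e"
        using e(3) greater above by (auto simp: desc_def)
      then show ?thesis
        using x(5)[of e] above[of e] greater e(2) c(2) by simp
    qed (use z in simp)
    moreover have "desc f z c" "f c z < s c"
      using x above c by (auto simp: desc_def)
    moreover have "f b' z = s b'"
      using above[of b'] b' c by simp
    ultimately have "X z"
      unfolding X_def using z x(2) b' less_trans by blast
    then show False
      using not_less_Least[of z X] z(2) by (simp add: x_def)
  qed
  then have "ascent f x c"
    unfolding ascent_def using x c by blast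
  then show ?thesis
    using b' by blast
qed

end

section \<open>The weak order, its projections and rotations\<close>

context positive_composition
begin

text \<open>Labels are bounded below by \<open>1\<close>, which would otherwise be rewritten to
  \<open>Suc 0\<close>.\<close>

declare One_nat_def [simp del]

abbreviation card_fun :: "planar_tree \<Rightarrow> nat \<Rightarrow> nat \<Rightarrow> nat"
  where "card_fun \<equiv> cardinality s"

abbreviation trees :: "planar_tree set"
  where "trees \<equiv> decreasing_trees n s"

lemma inversion_function_card_fun: "T \<in> trees \<Longrightarrow> inversion_function (card_fun T)"
  by (metis decreasing_trees_iff tree_inversion_cardinality)

lemma tree_antisym: "T \<in> trees \<Longrightarrow> T' \<in> trees \<Longrightarrow> card_fun T \<preceq> card_fun T' \<Longrightarrow> card_fun T' \<preceq> card_fun T \<Longrightarrow> T = T'"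
  unfolding decreasing_trees_iff by (rule decreasing_eqI[of s]) (auto simp: le_fun_def intro!: antisym)

lemma ex_tree:
  assumes "inversion_function f"
  obtains T where "T \<in> trees" "card_fun T \<preceq> f" "f \<preceq> card_fun T"
  using ex_decreasing_cardinality[OF _ assms] that by (auto simp: decreasing_trees_iff le_fun_def)

lemma le_fun_iff: "f \<preceq> g \<longleftrightarrow> (\<forall>x y. 1 \<le> x \<and> x < y \<and> y \<le> n \<longrightarrow> f y x \<le> g y x)"
  by (auto simp: le_fun_def)

lemma eq_iff_le_fun: "f \<preceq> g \<and> g \<preceq> f \<longleftrightarrow> (\<forall>a c. 1 \<le> a \<and> a < c \<and> c \<le> n \<longrightarrow> f c a = g c a)"
  unfolding le_fun_iff by (auto intro: antisym)

lemma carrier_weak_order [simp]: "carrier (s_weak_order n s) = trees"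
  by (simp add: s_weak_order_def)

lemma le_weak_order [simp]: "R \<sqsubseteq>\<^bsub>s_weak_order n s\<^esub> T \<longleftrightarrow> card_fun R \<preceq> card_fun T"
  by (simp add: s_weak_order_def le_fun_iff)

lemma eq_weak_order [simp]: "(.=\<^bsub>s_weak_order n s\<^esub>) = (=)"
  by (simp add: s_weak_order_def)

text \<open>One argument for the description operators of both projections: existence is
  \<open>ex_tree\<close>, uniqueness is \<open>tree_antisym\<close>.\<close>

lemma tree_of_projection:
  assumes "inversion_function f"
  defines "Q \<equiv> (THE Q. Q \<in> trees \<and> (\<forall>a c. 1 \<le> a \<and> a < c \<and> c \<le> n \<longrightarrow> card_fun Q c a = f c a))"
  shows "Q \<in> trees" "card_fun Q \<preceq> f" "f \<preceq> card_fun Q"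
proof -
  obtain T where T: "T \<in> trees" "card_fun T \<preceq> f" "f \<preceq> card_fun T"
    using ex_tree[OF assms(1)] .
  have "Q = T"
    unfolding Q_def
  proof (rule the_equality)
    show "T \<in> trees \<and> (\<forall>a c. 1 \<le> a \<and> a < c \<and> c \<le> n \<longrightarrow> card_fun T c a = f c a)"
      using T eq_iff_le_fun by blast
    show "T' = T" if "T' \<in> trees \<and> (\<forall>a c. 1 \<le> a \<and> a < c \<and> c \<le> n \<longrightarrow> card_fun T' c a = f c a)" for T'
    proof -
      have "card_fun T' \<preceq> f" "f \<preceq> card_fun T'"
        using that eq_iff_le_fun by blast+
      then show ?thesis
        using that tree_antisym[OF _ T(1)] le_fun_trans[OF _ T(3)] le_fun_trans[OF T(2)] by blast
    qed
  qed
  with T show "Q \<in> trees" "card_fun Q \<preceq> f" "f \<preceq> card_fun Q"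
    by simp_all
qed

lemma pi_up:
  assumes "T \<in> trees"
  shows "pi_up n s T \<in> trees" "card_fun (pi_up n s T) \<preceq> up_fun s (card_fun T)"
    "up_fun s (card_fun T) \<preceq> card_fun (pi_up n s T)"
  using tree_of_projection[OF inversion_function_up_fun[OF inversion_function_card_fun[OF assms]]]
  unfolding pi_up_def up_fun_def by simp_all

lemma pi_down:
  assumes "T \<in> trees"
  shows "pi_down n s T \<in> trees" "card_fun (pi_down n s T) \<preceq> down_fun (card_fun T)"
    "down_fun (card_fun T) \<preceq> card_fun (pi_down n s T)"
  using tree_of_projection[OF inversion_function_down_fun[OF inversion_function_card_fun[OF assms]]]
  unfolding pi_down_def down_fun_def by simp_all

section \<open>The finite lattice of decreasing trees\<close>

lemma lattice_weak_order: "lattice (s_weak_order n s)" (is "lattice ?L")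
proof
  fix R T
  assume R: "R \<in> carrier ?L" and T: "T \<in> carrier ?L"
  then have f: "inversion_function (card_fun R)" "inversion_function (card_fun T)"
    by (auto simp: inversion_function_card_fun)
  have p: "0 < s b" if "b \<in> {1..n}" for b
    using pos that by simp
  show "\<exists>U. least ?L U (Upper ?L {R, T})"
  proof -
    obtain h where h: "inversion_function h" "card_fun R \<preceq> h" "card_fun T \<preceq> h"
      "\<And>k. inversion_function k \<Longrightarrow> card_fun R \<preceq> k \<Longrightarrow> card_fun T \<preceq> k \<Longrightarrow> h \<preceq> k"
      using ex_join_tree_inversion[OF p f] by blast
    obtain U where U: "U \<in> trees" "card_fun U \<preceq> h" "h \<preceq> card_fun U"
      using ex_tree[OF h(1)] .
    have "card_fun R \<preceq> card_fun U" "card_fun T \<preceq> card_fun U"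
      using h(2,3) U(3) le_fun_trans by blast+
    moreover have "card_fun U \<preceq> card_fun V"
      if "V \<in> trees" "card_fun R \<preceq> card_fun V" "card_fun T \<preceq> card_fun V" for V
      using h(4)[OF inversion_function_card_fun that(2,3)] that(1) U(2) le_fun_trans by blast
    ultimately show ?thesis
      using U(1) R T by (intro exI[of _ U] least_UpperI) (auto simp: Upper_def)
  qed
  show "\<exists>U. greatest ?L U (Lower ?L {R, T})"
  proof -
    obtain h where h: "inversion_function h" "h \<preceq> card_fun R" "h \<preceq> card_fun T"
      "\<And>k. inversion_function k \<Longrightarrow> k \<preceq> card_fun R \<Longrightarrow> k \<preceq> card_fun T \<Longrightarrow> k \<preceq> h"
      using ex_meet_tree_inversion[OF p f] by blast
    obtain U where U: "U \<in> trees" "card_fun U \<preceq> h" "h \<preceq> card_fun U"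
      using ex_tree[OF h(1)] .
    have "card_fun U \<preceq> card_fun R" "card_fun U \<preceq> card_fun T"
      using h(2,3) U(2) le_fun_trans by blast+
    moreover have "card_fun V \<preceq> card_fun U"
      if "V \<in> trees" "card_fun V \<preceq> card_fun R" "card_fun V \<preceq> card_fun T" for V
      using h(4)[OF inversion_function_card_fun that(2,3)] that(1) U(3) le_fun_trans by blast
    ultimately show ?thesis
      using U(1) R T by (intro exI[of _ U] greatest_LowerI) (auto simp: Lower_def)
  qed
qed (auto intro: le_fun_refl le_fun_trans tree_antisym)

text \<open>A tree is determined by finitely many values, each bounded by the corresponding
  \<open>s y\<close>.\<close>

lemma finite_trees: "finite trees"
proof -
  define P where "P = {(y, x). 1 \<le> x \<and> x < y \<and> y \<le> n}"
  \<comment> \<open>\<open>restrict\<close> makes the tables of values extensional, so that they lie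
    in a finite \<open>PiE\<close>.\<close>
  define r where "r T = restrict (\<lambda>(y, x). card_fun T y x) P" for T
  have r_apply: "r T (y, x) = card_fun T y x" if "1 \<le> x" "x < y" "y \<le> n" for T x y
    using that by (simp add: r_def P_def)
  have "finite P"
    by (rule finite_subset[of _ "{..n} \<times> {..n}"]) (auto simp: P_def)
  have "r ` trees \<subseteq> PiE P (\<lambda>(y, x). {..s y})"
  proof (rule image_subsetI)
    fix T
    assume "T \<in> trees"
    then show "r T \<in> PiE P (\<lambda>(y, x). {..s y})"
      unfolding r_def using inv_le[OF inversion_function_card_fun] by (intro restrict_PiE_iff[THEN iffD2]) (auto simp: P_def)
  qed
  then have "finite (r ` trees)"
    by (rule finite_subset) (auto intro!: finite_PiE \<open>finite P\<close>)
  moreover have "inj_on r trees"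
  proof (rule inj_onI)
    fix T T'
    assume T: "T \<in> trees" "T' \<in> trees" and "r T = r T'"
    then have "card_fun T y x = card_fun T' y x" if "1 \<le> x" "x < y" "y \<le> n" for x y
      using r_apply[OF that] \<open>r T = r T'\<close> by metis
    then show "T = T'"
      using T by (intro tree_antisym) (auto simp: le_fun_def)
  qed
  ultimately show ?thesis
    by (rule finite_imageD)
qed

sublocale projections: projection_pair "s_weak_order n s" "pi_down n s" "pi_up n s"
proof (intro projection_pair.intro lattice_weak_order projection_pair_axioms.intro; simp)
  note I = inversion_function_card_fun
  note tr = le_fun_trans[of "{1..n}"]
  fix R T
  assume T: "T \<in> trees"
  show dT: "pi_down n s T \<in> trees" and uT: "pi_up n s T \<in> trees"
    using T by (simp_all add: pi_down pi_up)
  show le_T: "card_fun (pi_down n s T) \<preceq> card_fun T"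
    using tr[OF pi_down(2)[OF T] down_fun_le_self] .
  show T_le: "card_fun T \<preceq> card_fun (pi_up n s T)"
    using tr[OF le_up_fun[OF I[OF T]] pi_up(3)[OF T]] .
  have d_mono: "card_fun (pi_down n s R) \<preceq> card_fun (pi_down n s T)"
    if "R \<in> trees" "T \<in> trees" "card_fun R \<preceq> card_fun T" for R T
    using tr[OF tr[OF pi_down(2)[OF that(1)] down_fun_le_down_fun[OF that(3)]] pi_down(3)[OF that(2)]] .
  have u_mono: "card_fun (pi_up n s R) \<preceq> card_fun (pi_up n s T)"
    if "R \<in> trees" "T \<in> trees" "card_fun R \<preceq> card_fun T" for R T
    using tr[OF tr[OF pi_up(2)[OF that(1)] up_fun_le_up_fun[OF I[OF that(2)] that(3) I[OF that(1)]]]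
        pi_up(3)[OF that(2)]] .
  show "pi_down n s (pi_up n s T) = pi_down n s T"
  proof (rule tree_antisym)
    have le: "card_fun (pi_down n s (pi_up n s T)) \<preceq> card_fun T"
      using tr[OF tr[OF pi_down(2)[OF uT] down_fun_le_down_fun[OF pi_up(2)[OF T]]]
          down_fun_up_fun_le[OF I[OF T]]] .
    \<comment> \<open>Idempotence of \<open>down_fun\<close> turns the upper bound \<open>T\<close>
      into the upper bound \<open>pi_down n s T\<close>.\<close>
    have "down_fun (card_fun (pi_up n s T)) \<preceq> down_fun (card_fun (pi_down n s (pi_up n s T)))"
      using tr[OF _ down_fun_le_down_fun[OF pi_down(3)[OF uT]]] by (auto simp: le_fun_def down_fun_down_fun)
    then show "card_fun (pi_down n s (pi_up n s T)) \<preceq> card_fun (pi_down n s T)"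
      using tr[OF tr[OF pi_down(2)[OF uT]] tr[OF down_fun_le_down_fun[OF le] pi_down(3)[OF T]]] by blast
  qed (use T uT T_le d_mono in \<open>auto simp: pi_down\<close>)
  show "pi_up n s (pi_down n s T) = pi_up n s T"
  proof (rule tree_antisym)
    have le: "card_fun T \<preceq> card_fun (pi_up n s (pi_down n s T))"
      using tr[OF tr[OF le_up_fun_down_fun[OF I[OF T]]
          up_fun_le_up_fun[OF I[OF dT] pi_down(3)[OF T] inversion_function_down_fun[OF I[OF T]]]]
          pi_up(3)[OF dT]] .
    \<comment> \<open>Dually, idempotence of \<open>up_fun\<close> turns the lower bound
      \<open>T\<close> into the lower bound \<open>pi_up n s T\<close>.\<close>
    have "up_fun s (up_fun s (card_fun (pi_down n s T))) \<preceq> up_fun s (card_fun (pi_down n s T))"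
      by (auto simp: le_fun_def up_fun_up_fun)
    moreover have "up_fun s (card_fun (pi_up n s (pi_down n s T))) \<preceq> up_fun s (up_fun s (card_fun (pi_down n s T)))"
      using up_fun_le_up_fun[OF inversion_function_up_fun[OF I[OF dT]] pi_up(2)[OF dT] I[OF pi_up(1)[OF dT]]] .
    ultimately have "up_fun s (card_fun (pi_up n s (pi_down n s T))) \<preceq> card_fun (pi_up n s (pi_down n s T))"
      using tr pi_up(3)[OF dT] by blast
    moreover have "up_fun s (card_fun T) \<preceq> up_fun s (card_fun (pi_up n s (pi_down n s T)))"
      using up_fun_le_up_fun[OF I[OF pi_up(1)[OF dT]] le I[OF T]] .
    ultimately show "card_fun (pi_up n s T) \<preceq> card_fun (pi_up n s (pi_down n s T))"
      using tr pi_up(2)[OF T] by blast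
  qed (use T dT le_T u_mono in \<open>auto simp: pi_up\<close>)
  assume "R \<in> trees" "card_fun R \<preceq> card_fun T"
  then show "card_fun (pi_down n s R) \<preceq> card_fun (pi_down n s T)"
    "card_fun (pi_up n s R) \<preceq> card_fun (pi_up n s T)"
    using T d_mono u_mono by auto
qed

section \<open>Ascents and rotations of trees\<close>

lemma in_child_range: "T \<in> trees \<Longrightarrow> in_child T y i x \<Longrightarrow> 1 \<le> x \<and> x < y \<and> y \<le> n"
  using in_child_labels[of T y i x] in_child_less[of s T y i x] by (auto simp: decreasing_trees_iff)

lemma descendant_range: "T \<in> trees \<Longrightarrow> descendant T x y \<Longrightarrow> 1 \<le> x \<and> x < y \<and> y \<le> n"
  using in_child_range by (auto simp: descendant_def)

lemma descendant_iff_desc: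
  "T \<in> trees \<Longrightarrow> 1 \<le> a \<Longrightarrow> a < c \<Longrightarrow> c \<le> n \<Longrightarrow> descendant T a c \<longleftrightarrow> desc (card_fun T) a c"
  using descendant_iff_cardinality[of s T a c] by (auto simp: decreasing_trees_iff desc_def)

lemma in_child_iff_desc:
  "T \<in> trees \<Longrightarrow> 1 \<le> a \<Longrightarrow> a < c \<Longrightarrow> c \<le> n \<Longrightarrow> in_child T c i a \<longleftrightarrow> desc (card_fun T) a c \<and> card_fun T c a = i"
  using in_child_iff_cardinality[of s T c i a] descendant_iff_desc by (auto simp: decreasing_trees_iff)

lemma tree_ascent_iff_ascent:
  assumes T: "T \<in> trees"
  shows "tree_ascent s T a c \<longleftrightarrow> ascent (card_fun T) a c"
proof (cases "1 \<le> a \<and> a < c \<and> c \<le> n")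
  case True
  have le: "card_fun T c a \<noteq> s c \<longleftrightarrow> card_fun T c a < s c"
    using inv_le[OF inversion_function_card_fun[OF T], of a c] True by auto
  have "(\<exists>x. in_child T a (s a) x) \<longleftrightarrow> (\<exists>x. 1 \<le> x \<and> x < a \<and> desc (card_fun T) x a \<and> card_fun T a x = s a)"
    using in_child_range[OF T] in_child_iff_desc[OF T] True by (meson le_trans less_imp_le)
  moreover have "(descendant T a b \<longrightarrow> in_child T b (s b) a) \<longleftrightarrow> (desc (card_fun T) a b \<longrightarrow> card_fun T b a = s b)"
    if "a < b" "b < c" for b
    using that True descendant_iff_desc[OF T, of a b] in_child_iff_desc[OF T, of a b] by auto
  ultimately show ?thesis
    using True pos[of a] le descendant_iff_desc[OF T, of a c] in_child_iff_desc[OF T, of a c]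
    unfolding tree_ascent_def ascent_def by auto
next
  case False
  then show ?thesis
    using descendant_range[OF T] by (auto simp: tree_ascent_def ascent_def)
qed

text \<open>The multiplicities of the multiset that \<open>rotation\<close> closes, curried so that
  the closure is a \<open>walk_max\<close>.\<close>

definition raised :: "planar_tree \<Rightarrow> nat \<Rightarrow> nat \<Rightarrow> nat \<Rightarrow> nat \<Rightarrow> nat"
  where "raised T a c y x = count (add_mset (c, a) (inversions n s T)) (y, x)"

lemma raised_eq:
  assumes "ascent (card_fun T) a c"
  shows "raised T a c y x = (if 1 \<le> x \<and> x < y \<and> y \<le> n
    then if y = c \<and> x = a then Suc (card_fun T c a) else card_fun T y x else 0)"
  using assms by (auto simp: raised_def count_inversions ascent_def)

lemma count_tc_raised:
  "count (tc (add_mset (c, a) (inversions n s T))) (y, x) = walk_max (raised T a c) y x"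
  unfolding raised_def by (rule count_tc_walk_max)

lemma card_fun_le_raised:
  assumes "ascent (card_fun T) a c"
  shows "card_fun T \<preceq> walk_max (raised T a c)" "card_fun T c a < walk_max (raised T a c) c a"
proof -
  have "card_fun T y x \<le> walk_max (raised T a c) y x" if "1 \<le> x" "x < y" "y \<le> n" for x y
    using walk_max_ge[OF that(2), of "raised T a c"] that by (auto simp: raised_eq[OF assms] split: if_splits)
  then show "card_fun T \<preceq> walk_max (raised T a c)"
    by (simp add: le_fun_iff)
  show "card_fun T c a < walk_max (raised T a c) c a"
    using walk_max_ge[of a c "raised T a c"] assms by (auto simp: raised_eq[OF assms] ascent_def)
qed

text \<open>Only one entry changes: \<open>card_fun T c a < s c\<close> keeps it within bounds, and
  \<open>ascent_less\<close> keeps it planar. The other entries inherit planarity from the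
  tree.\<close>

lemma inversion_function_raised:
  assumes T: "T \<in> trees" and ac: "ascent (card_fun T) a c"
  shows "inversion_function (walk_max (raised T a c))"
proof (rule tree_inversion_walk_max)
  note f = inversion_function_card_fun[OF T]
  note g = raised_eq[OF ac]
  show "x \<in> {1..n} \<and> y \<in> {1..n} \<and> raised T a c y x \<le> s y" if "0 < raised T a c y x" "x < y" for x y
    using that ac inv_le[OF f, of x y] by (auto simp: g ascent_def split: if_splits)
  show "s b \<le> raised T a c b x \<or> raised T a c y x \<le> raised T a c y b"
    if x: "x \<in> {1..n}" "y \<in> {1..n}" "x < b" "b < y" for x b y
  proof (cases "card_fun T b x < s b")
    case True
    have "raised T a c y x \<le> card_fun T y b"
    proof (cases "y = c \<and> x = a")
      case True
      then show ?thesis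
        using ascent_less[OF f ac, of b] x \<open>card_fun T b x < s b\<close> by (simp add: g)
    next
      case False
      then show ?thesis
        using inv_planar[OF f, of x b y] x True by (auto simp: g)
    qed
    also have "\<dots> \<le> raised T a c y b"
      using x by (auto simp: g)
    finally show ?thesis
      by simp
  next
    case False
    then show ?thesis
      using x by (auto simp: g)
  qed
qed (use pos in auto)

lemma ex_rotation:
  assumes T: "T \<in> trees" and ac: "ascent (card_fun T) a c"
  shows "\<exists>T'. rotation n s a c T T'"
proof -
  let ?I = "add_mset (c, a) (inversions n s T)"
  obtain T' where T': "T' \<in> trees" "card_fun T' \<preceq> walk_max (raised T a c)" "walk_max (raised T a c) \<preceq> card_fun T'"
    using ex_tree[OF inversion_function_raised[OF assms]] .
  have "count (inversions n s T') (y, x) = count (tc ?I) (y, x)" for x y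
  proof (cases "1 \<le> x \<and> x < y \<and> y \<le> n")
    case True
    then show ?thesis
      using T'(2,3) le_invD by (auto simp: count_inversions count_tc_raised intro: antisym)
  next
    case False
    \<comment> \<open>The two multisets must agree everywhere; outside the range there are no walks,
      so both multiplicities vanish.\<close>
    have walk_range: "1 \<le> x \<and> x < y \<and> y \<le> n" if "walk (raised T a c) y x i" for i
      using that by (induction rule: walk.induct) (auto simp: raised_eq[OF ac] split: if_splits)
    have "walk_max (raised T a c) y x = 0"
      using walk_walk_max[of "raised T a c" y x] walk_range False by blast
    then show ?thesis
      using False by (auto simp: count_inversions count_tc_raised)
  qed
  then have "inversions n s T' = tc ?I"
    by (intro multiset_eqI) auto
  then show ?thesis
    using T T'(1) ac by (auto simp: rotation_def tree_ascent_iff_ascent)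
qed

lemma rotation_raised:
  assumes "rotation n s a c T T'"
  shows "T \<in> trees" "T' \<in> trees" "ascent (card_fun T) a c"
    "card_fun T' \<preceq> walk_max (raised T a c)" "walk_max (raised T a c) \<preceq> card_fun T'"
proof -
  show T: "T \<in> trees" and "T' \<in> trees" and "ascent (card_fun T) a c"
    using assms by (auto simp: rotation_def tree_ascent_iff_ascent)
  have "card_fun T' y x = walk_max (raised T a c) y x" if "1 \<le> x" "x < y" "y \<le> n" for x y
    using count_inversions[of n s T' y x] that assms by (simp add: rotation_def count_tc_raised)
  then show "card_fun T' \<preceq> walk_max (raised T a c)" "walk_max (raised T a c) \<preceq> card_fun T'"
    using eq_iff_le_fun by blast+
qed

text \<open>The witness \<open>b\<close> makes the function of \<open>pi_up\<close> full at
  \<open>(c, a)\<close>, so it dominates the raised entries; being transitive, it dominates their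
  closure.\<close>

lemma congruence_rotation_between:
  assumes "congruence_rotation n s T T'"
  shows "T \<in> trees" "T' \<in> trees" "card_fun T \<preceq> card_fun T'" "\<not> card_fun T' \<preceq> card_fun T"
    "card_fun T' \<preceq> card_fun (pi_up n s T)"
proof -
  obtain a b c where rot: "rotation n s a c T T'" and b: "a < b" "b < c" "card_fun T b a = s b"
    using assms by (auto simp: congruence_rotation_def)
  note R = rotation_raised[OF rot]
  show T: "T \<in> trees" and "T' \<in> trees"
    using R by auto
  show "card_fun T \<preceq> card_fun T'"
    using le_fun_trans[OF card_fun_le_raised(1)[OF R(3)] R(5)] .
  show "\<not> card_fun T' \<preceq> card_fun T"
    using le_invD[OF R(5), of a c] le_invD[of "card_fun T'" "card_fun T" a c] card_fun_le_raised(2)[OF R(3)] R(3)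
    by (auto simp: ascent_def)
  let ?h = "up_fun s (card_fun T)"
  have "raised T a c y x \<le> ?h y x" if "x \<in> {1..n}" "y \<in> {1..n}" "x < y" for x y
    using le_invD[OF le_up_fun[OF inversion_function_card_fun[OF T]], of x y]
      up_fun_eq_s[OF b(1,2), of "card_fun T" s] b that R(3)
    by (auto simp: raised_eq[OF R(3)] ascent_def)
  then have "walk_max (raised T a c) y x \<le> ?h y x" for x y
    by (intro walk_max_le[OF _ _ inversion_function_up_fun[OF inversion_function_card_fun[OF T]]])
      (auto simp: raised_eq[OF R(3)] split: if_splits)
  then show "card_fun T' \<preceq> card_fun (pi_up n s T)"
    using le_fun_trans[OF R(4) le_fun_trans[OF _ pi_up(3)[OF T]]] by (simp add: le_fun_def)
qed

text \<open>\<open>T'\<close> lies between \<open>T\<close> and the image of \<open>T\<close>, so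
  monotonicity and idempotence of \<open>pi_up\<close> give equality.\<close>

lemma congruence_rotation_pi_up:
  assumes "congruence_rotation n s T T'"
  shows "pi_up n s T = pi_up n s T'"
proof (rule tree_antisym)
  note T = congruence_rotation_between[OF assms]
  show "card_fun (pi_up n s T) \<preceq> card_fun (pi_up n s T')"
    using projections.u_mono[of T T'] T by simp
  show "card_fun (pi_up n s T') \<preceq> card_fun (pi_up n s T)"
    using projections.u_mono[of T' "pi_up n s T"] T pi_up(1)[OF T(1)] by simp
qed (use congruence_rotation_between[OF assms] pi_up in auto)

text \<open>Each congruence rotation strictly shrinks the finite set of trees above and preserves
  the target; when none is available, the tree is its own image under \<open>pi_up\<close>.\<close>

lemma rotations_to_pi_up: "T \<in> trees \<Longrightarrow> (congruence_rotation n s)\<^sup>*\<^sup>* T (pi_up n s T)"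
proof (induction "card {U \<in> trees. card_fun T \<preceq> card_fun U}" arbitrary: T rule: less_induct)
  case less
  note T = \<open>T \<in> trees\<close>
  show ?case
  proof (cases "up_fun s (card_fun T) \<preceq> card_fun T")
    case True
    have "pi_up n s T = T"
    proof (rule tree_antisym)
      show "card_fun (pi_up n s T) \<preceq> card_fun T"
        using le_fun_trans[OF pi_up(2)[OF T] True] .
      show "card_fun T \<preceq> card_fun (pi_up n s T)"
        using projections.le_u[of T] T by simp
    qed (use T pi_up in auto)
    then show ?thesis
      by simp
  next
    case False
    then obtain a b c where "ascent (card_fun T) a c" "a < b" "b < c" "card_fun T b a = s b"
      using ex_congruence_ascent[OF inversion_function_card_fun[OF T]] by blast
    moreover from this obtain T' where "rotation n s a c T T'"
      using ex_rotation[OF T] by blast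
    ultimately have rot: "congruence_rotation n s T T'"
      by (auto simp: congruence_rotation_def)
    note T' = congruence_rotation_between[OF rot]
    have "{U \<in> trees. card_fun T' \<preceq> card_fun U} \<subset> {U \<in> trees. card_fun T \<preceq> card_fun U}"
      using T'(1,2,4) le_fun_trans[OF T'(3)] le_fun_refl by blast
    then have "card {U \<in> trees. card_fun T' \<preceq> card_fun U} < card {U \<in> trees. card_fun T \<preceq> card_fun U}"
      using finite_trees by (intro psubset_card_mono) auto
    then have "(congruence_rotation n s)\<^sup>*\<^sup>* T' (pi_up n s T')"
      using less.hyps T'(2) by blast
    then show ?thesis
      using rot congruence_rotation_pi_up[OF rot] by simp
  qed
qed

section \<open>Equality of the three relations, and the Tamari trees\<close>

lemma fibres_eq_pi_up_equiv: "projections.fibres = pi_up_equiv n s"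
  by (simp add: projections.fibres_def pi_up_equiv_def)

lemma pi_down_equiv_eq: "pi_down_equiv n s = pi_up_equiv n s"
  using projections.u_eq_iff_d_eq by (auto simp: pi_down_equiv_def pi_up_equiv_def)

text \<open>Congruence rotations preserve \<open>pi_up\<close>; conversely, two trees with the same
  image under \<open>pi_up\<close> both reach it by such rotations.\<close>

lemma rotation_equiv_eq: "rotation_equiv n s = pi_up_equiv n s"
proof (intro equalityI subsetI; clarify)
  fix T T'
  assume "(T, T') \<in> rotation_equiv n s"
  then have T: "T \<in> trees" "T' \<in> trees" and "equivclp (congruence_rotation n s) T T'"
    by (auto simp: rotation_equiv_def)
  from this(3) have "pi_up n s T = pi_up n s T'"
    by (induction rule: equivclp_induct) (auto dest: congruence_rotation_pi_up)
  then show "(T, T') \<in> pi_up_equiv n s"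
    using T by (simp add: pi_up_equiv_def)
next
  fix T T'
  assume "(T, T') \<in> pi_up_equiv n s"
  then have T: "T \<in> trees" "T' \<in> trees" "pi_up n s T = pi_up n s T'"
    by (auto simp: pi_up_equiv_def)
  then have "equivclp (congruence_rotation n s) T (pi_up n s T)" "equivclp (congruence_rotation n s) T' (pi_up n s T)"
    using rotations_to_pi_up rtranclp_into_equivclp by metis+
  then have "equivclp (congruence_rotation n s) T T'"
    using equivclp_sym equivclp_trans by metis
  then show "(T, T') \<in> rotation_equiv n s"
    using T by (simp add: rotation_equiv_def)
qed

lemma tamari_trees_eq: "tamari_trees n s = {T \<in> trees. pi_down n s T = T}"
proof -
  have "pi_down n s T = T \<longleftrightarrow> (\<forall>a b c. 1 \<le> a \<and> a < b \<and> b < c \<and> c \<le> n \<longrightarrow> card_fun T c a \<le> card_fun T c b)"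
    if T: "T \<in> trees" for T
  proof -
    have "pi_down n s T = T \<longleftrightarrow> card_fun T \<preceq> down_fun (card_fun T)"
      using tree_antisym[OF pi_down(1)[OF T] T] pi_down[OF T] down_fun_le_self le_fun_trans by metis
    also have "\<dots> \<longleftrightarrow> (\<forall>a c. 1 \<le> a \<and> a < c \<and> c \<le> n \<longrightarrow> down_fun (card_fun T) c a = card_fun T c a)"
      using eq_iff_le_fun down_fun_le_self by blast
    finally show ?thesis
      unfolding down_fun_eq_iff .
  qed
  then show ?thesis
    by (auto simp: tamari_trees_def)
qed

text \<open>The shape in which \<open>projections.fixed_points_isomorphic_quotient\<close>
  applies.\<close>

lemma s_tamari_lattice_eq:
  "s_tamari_lattice n s =
    (s_weak_order n s)\<lparr>carrier := {T \<in> carrier (s_weak_order n s). pi_down n s T = T}\<rparr>"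
  by (simp add: s_tamari_lattice_def tamari_trees_eq)

end

theorem theorem2p20:
  fixes n :: nat and s :: "nat \<Rightarrow> nat"
  assumes "composition n s"
  shows "rotation_equiv n s = pi_up_equiv n s
    \<and> pi_down_equiv n s = pi_up_equiv n s
    \<and> lattice_congruence (s_weak_order n s) (pi_up_equiv n s)
    \<and> lattice_isomorphic (s_tamari_lattice n s)
        (quotient_order (s_weak_order n s) (pi_down_equiv n s))"
proof -
  interpret positive_composition n s
    by unfold_locales (fact assms)
  show ?thesis
    using rotation_equiv_eq pi_down_equiv_eq projections.lattice_congruence_fibres
      projections.fixed_points_isomorphic_quotient finite_trees
    by (simp add: fibres_eq_pi_up_equiv s_tamari_lattice_eq)
qed

end
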